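(* For each integer $r \ge 3$, \[ \ln s(n,r) = \frac{1}{n-r+1}\binom{n}{r}\Bigl(\ln(n-r+1) + 1 - r + o(1)\Bigr) \qquad \text{as } n \to \infty . \]
   Context: A matroid of rank $r$ on ground set $E$ is paving if every subset $F\subseteq E$ with $|F|<r$ is independent. It is sparse paving if it is paving and every hyperplane has cardinality $r-1$ or $r$. $s(n,r)$ denotes the number of sparse paving matroids of rank $r$ on the ground set $[n]=\{1,\dots,n\}$. *)

theory Defs
  imports Complex_Main "HOL-Library.Landau_Symbols"
begin

text \<open>A matroid on the finite ground set \<open>E\<close> is given by its family \<open>\<I>\<close> of independent sets.\<close>

locale matroid =
  fixes E :: "'a set" and \<I> :: "'a set set"
  assumes finite_ground: "finite E"
    and indep_subset_ground: "X \<in> \<I> \<Longrightarrow> X \<subseteq> E"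
    and indep_empty: "{} \<in> \<I>"
    and indep_subset: "X \<in> \<I> \<Longrightarrow> Y \<subseteq> X \<Longrightarrow> Y \<in> \<I>"
    and indep_augment:
      "X \<in> \<I> \<Longrightarrow> Y \<in> \<I> \<Longrightarrow> card X < card Y \<Longrightarrow> \<exists>y\<in>Y - X. insert y X \<in> \<I>"

definition rank_of :: "'a set set \<Rightarrow> 'a set \<Rightarrow> nat" where
  "rank_of \<I> X = Max (card ` {Y \<in> \<I>. Y \<subseteq> X})"

definition flat :: "'a set \<Rightarrow> 'a set set \<Rightarrow> 'a set \<Rightarrow> bool" where
  "flat E \<I> F \<longleftrightarrow> F \<subseteq> E \<and> (\<forall>x\<in>E - F. rank_of \<I> F < rank_of \<I> (insert x F))"

definition hyperplane :: "'a set \<Rightarrow> 'a set set \<Rightarrow> 'a set \<Rightarrow> bool" where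
  "hyperplane E \<I> H \<longleftrightarrow> flat E \<I> H \<and> rank_of \<I> H + 1 = rank_of \<I> E"

definition paving :: "'a set \<Rightarrow> 'a set set \<Rightarrow> bool" where
  "paving E \<I> \<longleftrightarrow> matroid E \<I> \<and> (\<forall>F\<subseteq>E. card F < rank_of \<I> E \<longrightarrow> F \<in> \<I>)"

definition sparse_paving :: "'a set \<Rightarrow> 'a set set \<Rightarrow> bool" where
  "sparse_paving E \<I> \<longleftrightarrow> paving E \<I> \<and>
     (\<forall>H. hyperplane E \<I> H \<longrightarrow> card H = rank_of \<I> E - 1 \<or> card H = rank_of \<I> E)"

definition num_sparse_paving :: "nat \<Rightarrow> nat \<Rightarrow> nat" where
  "num_sparse_paving n r =
     card {\<I> :: nat set set. sparse_paving {1..n} \<I> \<and> rank_of \<I> {1..n} = r}"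

lemma finite_sparse_paving:
  "finite {\<I> :: nat set set. sparse_paving {1..n} \<I> \<and> rank_of \<I> {1..n} = r}"
proof (rule finite_subset)
  show "{\<I> :: nat set set. sparse_paving {1..n} \<I> \<and> rank_of \<I> {1..n} = r} \<subseteq> Pow (Pow {1..n})"
    unfolding sparse_paving_def paving_def by (auto dest: matroid.indep_subset_ground)
qed simp

end

theory Submission
  imports Defs "HOL-Real_Asymp.Real_Asymp"
begin

text \<open>
  A sparse paving matroid of rank \<open>r\<close> on \<open>[n]\<close> is determined by its dependent \<open>r\<close>-sets, and these may be
  any family of \<open>r\<close>-sets that pairwise meet in fewer than \<open>r - 1\<close> points. Regarding an \<open>r\<close>-set as the
  edge consisting of its \<open>r\<close> facets, such families are the matchings of a linear \<open>k\<close>-uniform \<open>D\<close>-regular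
  hypergraph on \<open>N = binomial n (r - 1)\<close> vertices, where \<open>k = r\<close> and \<open>D = n - r + 1\<close>. With \<open>P = N / k\<close>
  the number of its matchings is \<open>exp (P * (ln D + 1 - k + o(1)))\<close>.

  Upper bound: reveal the edges of a uniformly random \<open>m\<close>-matching in random order. When a fraction \<open>x\<close>
  of them is still hidden, a given edge is disjoint from everything revealed with probability about
  \<open>x ^ k\<close>, so the next edge has about \<open>P * D * x ^ k\<close> possible values on average. By the chain rule and
  concavity the logarithm of the number of matchings is at most the sum of the logarithms of these
  averages, minus \<open>ln m!\<close>.

  Lower bound: choose edges greedily. As long as every uncovered vertex lies in \<open>(1 + o(1)) * D * x ^ (k - 1)\<close>
  available edges, \<open>x\<close> being the fraction of uncovered vertices, there are about \<open>P * D * x ^ k\<close> choices for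
  the next edge. The relative error of a degree has almost no drift under a uniformly random choice, so
  the sum over the vertices of the exponentials of the scaled errors is a supermartingale. Weighting each
  matching by \<open>1\<close> minus this potential turns the probabilistic argument into an induction on the
  number of edges.
\<close>

section \<open>Linear hypergraphs and their matchings\<close>

locale linear_hypergraph =
  fixes V :: "'v set" and H :: "'v set set" and k D :: nat
  assumes finite_V: "finite V"
    and edge_subset: "e \<in> H \<Longrightarrow> e \<subseteq> V"
    and edge_card: "e \<in> H \<Longrightarrow> card e = k"
    and degree: "v \<in> V \<Longrightarrow> card {e \<in> H. v \<in> e} = D"
    and linear: "e \<in> H \<Longrightarrow> f \<in> H \<Longrightarrow> e \<noteq> f \<Longrightarrow> card (e \<inter> f) \<le> 1"
    and k_ge_2: "2 \<le> k"
    and D_pos: "0 < D"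
    and V_nonempty: "V \<noteq> {}"
begin

section \<open>Matchings, available edges and uncovered vertices\<close>

definition matchings :: "nat \<Rightarrow> 'v set set set" where
  "matchings i = {M. M \<subseteq> H \<and> pairwise disjnt M \<and> card M = i}"

definition avail :: "'v set set \<Rightarrow> 'v set set" where
  "avail M = {f \<in> H. f \<inter> \<Union>M = {}}"

definition uncovered :: "'v set set \<Rightarrow> 'v set" where
  "uncovered M = V - \<Union>M"

definition deg :: "'v set set \<Rightarrow> 'v \<Rightarrow> nat" where
  "deg M v = card {e \<in> avail M. v \<in> e}"

lemma finite_H: "finite H"
  by (rule finite_subset[of _ "Pow V"]) (auto simp: finite_V dest: edge_subset)

lemma finite_edge: "e \<in> H \<Longrightarrow> finite e"
  using edge_subset finite_V finite_subset by blast

lemma edge_nonempty: "e \<in> H \<Longrightarrow> e \<noteq> {}"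
  using edge_card k_ge_2 by fastforce

lemma card_V_pos: "0 < card V"
  using finite_V V_nonempty by (simp add: card_gt_0_iff)

lemma finite_matchings: "finite (matchings i)"
  by (rule finite_subset[of _ "Pow H"]) (auto simp: matchings_def finite_H)

lemma matchingsD:
  assumes "M \<in> matchings i"
  shows "M \<subseteq> H" "pairwise disjnt M" "card M = i" "finite M"
  using assms finite_subset[OF _ finite_H] by (auto simp: matchings_def)

lemma finite_avail: "finite (avail M)"
  by (simp add: avail_def finite_H)

lemma finite_uncovered: "finite (uncovered M)"
  by (simp add: uncovered_def finite_V)

lemma avail_subset: "avail M \<subseteq> H"
  by (auto simp: avail_def)

lemma avail_notin: "f \<in> avail M \<Longrightarrow> f \<notin> M"
  using edge_nonempty[of f] by (auto simp: avail_def)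

lemma avail_subset_uncovered: "f \<in> avail M \<Longrightarrow> f \<subseteq> uncovered M"
  using edge_subset[of f] by (auto simp: avail_def uncovered_def)

lemma avail_insert: "avail (insert f M) = {e \<in> avail M. e \<inter> f = {}}"
  by (auto simp: avail_def)

lemma uncovered_insert: "uncovered (insert f M) = uncovered M - f"
  by (auto simp: uncovered_def)

lemma matchings_0: "matchings 0 = {{}}"
proof -
  have "M = {}" if "M \<subseteq> H" "card M = 0" for M
    using that finite_H finite_subset[of M H] by simp
  then show ?thesis
    by (auto simp: matchings_def)
qed

lemma insert_matching:
  assumes "M \<in> matchings i" "f \<in> avail M"
  shows "insert f M \<in> matchings (Suc i)"
proof -
  have "pairwise disjnt (insert f M)"
    using assms matchingsD(2)[OF assms(1)]
    by (auto simp: pairwise_insert avail_def disjnt_def)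
  then show ?thesis
    using assms avail_notin[OF assms(2)] matchingsD[OF assms(1)] avail_subset[of M]
    by (auto simp: matchings_def)
qed

lemma remove_matching:
  assumes "J \<in> matchings (Suc i)" "f \<in> J"
  shows "J - {f} \<in> matchings i" "f \<in> avail (J - {f})"
proof -
  note J = matchingsD[OF assms(1)]
  show "J - {f} \<in> matchings i"
    using J assms(2) by (auto simp: matchings_def intro: pairwise_subset)
  have "f \<inter> e = {}" if "e \<in> J - {f}" for e
    using J(2) assms(2) that unfolding pairwise_def disjnt_def by blast
  then show "f \<in> avail (J - {f})"
    using J(1) assms(2) by (auto simp: avail_def)
qed

text \<open>Double counting of pairs of an (i+1)-matching and one of its edges: deleting the edge
  leaves an i-matching for which it was available. Both the greedy count and the entropy bound climb
  from size \<open>i\<close> to \<open>Suc i\<close> with this identity.\<close>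

lemma sum_matchings_Suc:
  fixes g :: "'v set set \<Rightarrow> real"
  shows "(\<Sum>M\<in>matchings i. \<Sum>f\<in>avail M. g (insert f M)) = (real i + 1) * (\<Sum>J\<in>matchings (Suc i). g J)"
proof -
  have "(\<Sum>M\<in>matchings i. \<Sum>f\<in>avail M. g (insert f M))
      = (\<Sum>(M, f)\<in>Sigma (matchings i) avail. g (insert f M))"
    by (subst sum.Sigma) (auto simp: finite_matchings finite_avail)
  also have "\<dots> = (\<Sum>(J, f)\<in>Sigma (matchings (Suc i)) (\<lambda>J. J). g J)"
    by (rule sum.reindex_bij_witness[where
          j = "\<lambda>(M, f). (insert f M, f)" and i = "\<lambda>(J, f). (J - {f}, f)"])
       (auto simp: insert_matching remove_matching insert_absorb avail_notin)
  also have "\<dots> = (\<Sum>J\<in>matchings (Suc i). \<Sum>f\<in>J. g J)"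
    by (subst sum.Sigma) (auto simp: finite_matchings dest: matchingsD(4))
  also have "\<dots> = (\<Sum>J\<in>matchings (Suc i). (real i + 1) * g J)"
    by (rule sum.cong) (auto dest: matchingsD(3))
  finally show ?thesis
    by (simp add: sum_distrib_left)
qed

lemma card_Union_matching:
  assumes "M \<in> matchings i"
  shows "card (\<Union>M) = i * k"
proof -
  have "card (\<Union>M) = (\<Sum>e\<in>M. card e)"
    using matchingsD[OF assms] finite_edge by (intro card_Union_disjoint) auto
  also have "\<dots> = (\<Sum>e\<in>M. k)"
    using matchingsD(1)[OF assms] edge_card by (intro sum.cong) auto
  finally show ?thesis
    using matchingsD(3)[OF assms] by simp
qed

lemma card_uncovered:
  assumes "M \<in> matchings i"
  shows "card (uncovered M) + i * k = card V"
proof -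
  have sub: "\<Union>M \<subseteq> V"
    using matchingsD(1)[OF assms] edge_subset by blast
  then have "card (uncovered M) = card V - card (\<Union>M)"
    unfolding uncovered_def using finite_V finite_subset by (intro card_Diff_subset) auto
  moreover have "card (\<Union>M) \<le> card V"
    using sub finite_V card_mono by blast
  ultimately show ?thesis
    using card_Union_matching[OF assms] by simp
qed

section \<open>Degrees and the degree lost when an edge is chosen\<close>

lemma sum_degrees:
  assumes "finite A" "finite X"
  shows "(\<Sum>v\<in>X. card {e \<in> A. v \<in> e}) = (\<Sum>e\<in>A. card (e \<inter> X))"
proof -
  have "(\<Sum>v\<in>X. card {e \<in> A. v \<in> e}) = (\<Sum>v\<in>X. \<Sum>e\<in>A. if v \<in> e then 1 else 0)"
    using assms by (intro sum.cong) (auto simp: sum.If_cases Int_def)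
  also have "\<dots> = (\<Sum>e\<in>A. \<Sum>v\<in>X. if v \<in> e then 1 else 0)"
    by (rule sum.swap)
  also have "\<dots> = (\<Sum>e\<in>A. card (e \<inter> X))"
    using assms by (intro sum.cong) (auto simp: sum.If_cases Int_def conj_commute)
  finally show ?thesis .
qed

lemma sum_deg: "(\<Sum>v\<in>uncovered M. deg M v) = k * card (avail M)"
proof -
  have "(\<Sum>v\<in>uncovered M. deg M v) = (\<Sum>e\<in>avail M. card (e \<inter> uncovered M))"
    unfolding deg_def by (rule sum_degrees) (auto simp: finite_avail finite_uncovered)
  also have "\<dots> = (\<Sum>e\<in>avail M. k)"
    using avail_subset_uncovered avail_subset edge_card
    by (intro sum.cong) (auto simp: Int_absorb2 subset_iff)
  finally show ?thesis
    by simp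
qed

lemma card_H: "card V * D = k * card H"
  using sum_deg[of "{}"] by (simp add: uncovered_def deg_def avail_def degree)

text \<open>The available edges at \<open>v\<close> that choosing \<open>f\<close> destroys. The
  value 0 for \<open>v \<in> f\<close> is a convention: such a vertex becomes covered and its degree
  is no longer followed.\<close>

definition loss :: "'v set set \<Rightarrow> 'v \<Rightarrow> 'v set \<Rightarrow> nat" where
  "loss M v f = (if v \<in> f then 0 else card {e \<in> avail M. v \<in> e \<and> e \<inter> f \<noteq> {}})"

lemma deg_insert:
  assumes "v \<notin> f"
  shows "deg (insert f M) v + loss M v f = deg M v"
proof -
  have "{e \<in> avail M. v \<in> e} = {e \<in> avail (insert f M). v \<in> e} \<union> {e \<in> avail M. v \<in> e \<and> e \<inter> f \<noteq> {}}"
    by (auto simp: avail_insert)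
  then have "deg M v = card \<dots>"
    by (simp add: deg_def)
  also have "\<dots> = deg (insert f M) v + loss M v f"
    unfolding deg_def loss_def using assms
    by (subst card_Un_disjoint) (auto simp: finite_avail avail_insert)
  finally show ?thesis ..
qed

lemma two_common_points:
  assumes "e \<in> H" "f \<in> H" "v \<in> e" "v \<in> f" "w \<in> e" "w \<in> f" "v \<noteq> w"
  shows "e = f"
proof (rule ccontr)
  assume "e \<noteq> f"
  then have "card (e \<inter> f) \<le> 1"
    using assms linear by blast
  moreover have "card {v, w} \<le> card (e \<inter> f)"
    using assms finite_edge by (intro card_mono) auto
  ultimately show False
    using assms by simp
qed

text \<open>Distinct edges through \<open>v\<close> share no second point, so mapping each destroyed
  edge to a point where it meets \<open>f\<close> is injective.\<close>

lemma loss_le: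
  assumes "f \<in> H"
  shows "loss M v f \<le> k"
proof (cases "v \<in> f")
  case False
  define S where "S = {e \<in> avail M. v \<in> e \<and> e \<inter> f \<noteq> {}}"
  define p where "p e = (SOME w. w \<in> e \<inter> f)" for e
  have p: "p e \<in> e \<inter> f" if "e \<in> S" for e
  proof -
    have "\<exists>w. w \<in> e \<inter> f"
      using that by (auto simp: S_def)
    then show ?thesis
      unfolding p_def by (rule someI_ex)
  qed
  have "inj_on p S"
  proof (rule inj_onI)
    fix e e' assume "e \<in> S" "e' \<in> S" "p e = p e'"
    then show "e = e'"
      using p[of e] p[of e'] False avail_subset
      by (intro two_common_points[of e e' v "p e"]) (auto simp: S_def)
  qed
  moreover have "p ` S \<subseteq> f"
    using p by blast
  ultimately have "card S \<le> card f"
    using card_inj_on_le finite_edge[OF assms] by blast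
  then show ?thesis
    using False edge_card[OF assms] by (simp add: loss_def S_def)
qed (simp add: loss_def)

text \<open>Counts pairs of an edge \<open>e\<close> at \<open>v\<close> and an edge
  \<open>f\<close> that avoids \<open>v\<close> and destroys \<open>e\<close>. By linearity
  \<open>f\<close> meets \<open>e\<close> in exactly one point \<open>w \<noteq> v\<close>, and
  conversely every other available edge at \<open>w\<close> avoids \<open>v\<close>; the
  \<open>- 1\<close> removes \<open>e\<close> itself.\<close>

lemma sum_loss:
  "(\<Sum>f\<in>avail M. loss M v f) = (\<Sum>e\<in>{e \<in> avail M. v \<in> e}. \<Sum>w\<in>e - {v}. deg M w - 1)"
proof -
  let ?A = "avail M" and ?E = "{e \<in> avail M. v \<in> e}"
  have "(\<Sum>f\<in>?A. loss M v f) = (\<Sum>f\<in>?A. \<Sum>e\<in>?E. if v \<notin> f \<and> e \<inter> f \<noteq> {} then 1 else 0)"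
    by (intro sum.cong) (auto simp: loss_def sum.If_cases finite_avail Int_def conj_ac
        intro!: arg_cong[where f = card])
  also have "\<dots> = (\<Sum>e\<in>?E. \<Sum>f\<in>?A. if v \<notin> f \<and> e \<inter> f \<noteq> {} then 1 else 0)"
    by (rule sum.swap)
  also have "\<dots> = (\<Sum>e\<in>?E. card {f \<in> ?A. v \<notin> f \<and> e \<inter> f \<noteq> {}})"
    by (intro sum.cong) (auto simp: sum.If_cases finite_avail Int_def intro!: arg_cong[where f = card])
  also have "\<dots> = (\<Sum>e\<in>?E. \<Sum>w\<in>e - {v}. deg M w - 1)"
  proof (rule sum.cong)
    fix e assume e: "e \<in> ?E"
    then have eH: "e \<in> H" and ve: "v \<in> e" and eA: "e \<in> ?A"
      using avail_subset by auto
    have eq: "{f \<in> ?A. v \<notin> f \<and> e \<inter> f \<noteq> {}} = (\<Union>w\<in>e - {v}. {f \<in> ?A. w \<in> f} - {e})"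
      using eH ve avail_subset by (fastforce dest: two_common_points[of e _ v])
    have "card {f \<in> ?A. v \<notin> f \<and> e \<inter> f \<noteq> {}} = (\<Sum>w\<in>e - {v}. card ({f \<in> ?A. w \<in> f} - {e}))"
      unfolding eq
    proof (rule card_UN_disjoint)
      show "\<forall>i\<in>e - {v}. \<forall>j\<in>e - {v}. i \<noteq> j \<longrightarrow> ({f \<in> ?A. i \<in> f} - {e}) \<inter> ({f \<in> ?A. j \<in> f} - {e}) = {}"
        using eH avail_subset by (auto dest: two_common_points[of e])
    qed (auto simp: finite_avail finite_edge eH)
    also have "\<dots> = (\<Sum>w\<in>e - {v}. deg M w - 1)"
      using eA by (intro sum.cong) (auto simp: deg_def card_Diff_singleton finite_avail)
    finally show "card {f \<in> ?A. v \<notin> f \<and> e \<inter> f \<noteq> {}} = (\<Sum>w\<in>e - {v}. deg M w - 1)" .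
  qed simp
  finally show ?thesis .
qed

end

section \<open>Lower bound for the number of matchings\<close>

lemma exp_le_quadratic:
  fixes y :: real
  assumes "\<bar>y\<bar> \<le> 1"
  shows "exp y \<le> 1 + y + y\<^sup>2"
proof (cases "0 \<le> y")
  case True
  then show ?thesis
    using assms exp_bound[of y] by simp
next
  case False
  define x where "x = - y"
  have x: "0 < x" "x \<le> 1"
    using False assms by (auto simp: x_def)
  \<comment> \<open>Multiplying the claimed bound for \<open>exp (- x)\<close> by the quadratic
    Taylor minorant of \<open>exp x\<close> leaves 1 plus nonnegative terms.\<close>
  have "(1 - x + x\<^sup>2) * (1 + x + x\<^sup>2 / 2) = 1 + x\<^sup>2 / 2 + x ^ 3 / 2 + x ^ 4 / 2"
    by (simp add: field_simps power2_eq_square power3_eq_cube power4_eq_xxxx)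
  then have "1 \<le> (1 - x + x\<^sup>2) * (1 + x + x\<^sup>2 / 2)"
    using x by simp
  also have "\<dots> \<le> (1 - x + x\<^sup>2) * exp x"
    using exp_lower_Taylor_quadratic[of x] x by (intro mult_left_mono) auto
  finally have "exp (- x) \<le> 1 - x + x\<^sup>2"
    by (simp add: exp_minus field_simps)
  then show ?thesis
    by (simp add: x_def)
qed

text \<open>The relative degree \<open>g\<close> of a vertex becomes \<open>\<rho> * (g - l f / d)\<close> when the edge \<open>f\<close> is chosen;
  the drift cancels to first order because \<open>\<rho>\<close> is close to \<open>1 + q\<close> and the mean of \<open>l f / d\<close> to \<open>g * q\<close>.\<close>

lemma sum_exp_drift_le:
  fixes l :: "'f \<Rightarrow> real" and k d g q \<rho> \<epsilon> \<theta> s :: real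
  assumes fin: "finite A"
    and l: "\<And>f. f \<in> A \<Longrightarrow> 0 \<le> l f" "\<And>f. f \<in> A \<Longrightarrow> l f \<le> k"
    and d: "0 < d" and k: "0 \<le> k" and g: "0 \<le> g" "g \<le> 2"
    and q: "0 \<le> q" "q \<le> \<epsilon>" "q \<le> k / d" and \<epsilon>: "\<epsilon> \<le> 1 / 4"
    and \<rho>: "1 + q \<le> \<rho>" "\<rho> * (1 - q) \<le> 1"
    and mean: "\<bar>sum l A / d - g * real (card A) * q\<bar> \<le> 4 * \<epsilon> * (g * real (card A) * q)"
    and \<theta>: "0 \<le> \<theta>" "64 * k * \<theta> \<le> \<epsilon> * d" and s: "\<bar>s\<bar> = 1"
  shows "(\<Sum>f\<in>A. exp (s * \<theta> * (\<rho> * (g - l f / d) - g))) \<le> real (card A) * exp (19 * \<theta> * \<epsilon> * q)"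
proof -
  define a where "a = real (card A)"
  define \<Delta> where "\<Delta> f = \<rho> * (g - l f / d) - g" for f
  have a0: "0 \<le> a" and \<epsilon>0: "0 \<le> \<epsilon>"
    using q by (auto simp: a_def)
  have "\<rho> * (3 / 4) \<le> \<rho> * (1 - q)"
    using \<rho>(1) q \<epsilon> by (intro mult_left_mono) auto
  then have \<rho>43: "\<rho> \<le> 4 / 3" and \<rho>1: "1 \<le> \<rho>"
    using \<rho> q by linarith+
  \<comment> \<open>\<open>\<rho>\<close> lies between \<open>1 + q\<close> and
    \<open>1 / (1 - q)\<close>, so the drift cancels up to order \<open>q * q\<close>.\<close>
  have "\<rho> * (1 - q) \<ge> (1 + q) * (1 - q)"
    using \<rho>(1) q \<epsilon> by (intro mult_right_mono) auto
  then have c: "\<bar>\<rho> * (1 - q) - 1\<bar> \<le> q * q"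
    using \<rho>(2) by (auto simp: algebra_simps abs_if)
  have "\<rho> * q \<le> (4 / 3) * q"
    using \<rho>43 q(1) by (intro mult_right_mono) auto
  then have \<rho>q: "\<rho> - 1 \<le> (4 / 3) * q"
    using \<rho>(2) by (simp add: algebra_simps)
  \<comment> \<open>The deviation of the total relative loss from its predicted value
    \<open>g * a * q\<close>.\<close>
  define \<tau> where "\<tau> = sum l A / d - g * a * q"
  have gaq: "g * a * q \<le> 2 * (a * q)" "0 \<le> g * a * q"
    using mult_right_mono[OF g(2), of "a * q"] g a0 q(1) by (auto simp: algebra_simps)
  have \<tau>: "\<bar>\<tau>\<bar> \<le> 8 * \<epsilon> * q * a"
  proof -
    have "\<bar>\<tau>\<bar> \<le> 4 * \<epsilon> * (g * a * q)"
      using mean by (simp add: \<tau>_def a_def)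
    also have "\<dots> \<le> 4 * \<epsilon> * (2 * (a * q))"
      using gaq \<epsilon>0 by (intro mult_left_mono) auto
    finally show ?thesis by (simp add: algebra_simps)
  qed
  have sum_ld: "(\<Sum>f\<in>A. l f / d) = \<tau> + g * a * q"
    by (simp add: \<tau>_def sum_divide_distrib)
  have "sum \<Delta> A = (\<Sum>f\<in>A. (\<rho> - 1) * g - \<rho> * (l f / d))"
    by (intro sum.cong) (auto simp: \<Delta>_def algebra_simps)
  also have "\<dots> = a * ((\<rho> - 1) * g) - \<rho> * (\<tau> + g * a * q)"
    by (simp only: sum_subtractf sum_constant a_def[symmetric] sum_distrib_left[symmetric] sum_ld)
  also have "\<dots> = a * g * (\<rho> * (1 - q) - 1) - \<rho> * \<tau>"
    by (simp add: algebra_simps)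
  finally have S1: "sum \<Delta> A = a * g * (\<rho> * (1 - q) - 1) - \<rho> * \<tau>" .
  have "\<bar>sum \<Delta> A\<bar> \<le> \<bar>a * g * (\<rho> * (1 - q) - 1)\<bar> + \<bar>\<rho> * \<tau>\<bar>"
    unfolding S1 by (rule abs_triangle_ineq4)
  also have "\<dots> = a * g * \<bar>\<rho> * (1 - q) - 1\<bar> + \<rho> * \<bar>\<tau>\<bar>"
    using a0 g \<rho>1 by (simp add: abs_mult)
  also have "\<dots> \<le> a * 2 * (\<epsilon> * q) + (4 / 3) * (8 * \<epsilon> * q * a)"
  proof (intro add_mono mult_mono)
    show "\<bar>\<rho> * (1 - q) - 1\<bar> \<le> \<epsilon> * q"
      using c mult_right_mono[OF q(2) q(1)] by linarith
  qed (use a0 g \<rho>43 \<rho>1 \<tau> \<epsilon>0 q in auto)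
  also have "\<dots> \<le> 18 * (\<epsilon> * q * a)"
  proof -
    have "0 \<le> \<epsilon> * q * a"
      using \<epsilon>0 q a0 by simp
    then show ?thesis by (simp add: algebra_simps)
  qed
  finally have mean\<Delta>: "\<bar>sum \<Delta> A\<bar> \<le> 18 * (\<epsilon> * q * a)" .
  have \<Delta>_eq: "\<Delta> f = (\<rho> - 1) * g - \<rho> * (l f / d)" for f
    by (simp add: \<Delta>_def algebra_simps)
  have lin: "0 \<le> (\<rho> - 1) * g" "(\<rho> - 1) * g \<le> (8 / 3) * q" "0 \<le> \<rho> * (l f / d)"
      "\<rho> * (l f / d) \<le> (4 / 3) * (l f / d)" "l f / d \<le> k / d" "0 \<le> l f / d" if "f \<in> A" for f
  proof -
    have "(\<rho> - 1) * g \<le> ((4 / 3) * q) * 2"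
      using \<rho>q g \<rho>1 q(1) by (intro mult_mono) auto
    then show "(\<rho> - 1) * g \<le> (8 / 3) * q" by simp
    show "0 \<le> l f / d" "l f / d \<le> k / d" "0 \<le> (\<rho> - 1) * g"
      using l[OF that] d \<rho>1 g by (auto simp: divide_right_mono)
    then show "\<rho> * (l f / d) \<le> (4 / 3) * (l f / d)" "0 \<le> \<rho> * (l f / d)"
      using \<rho>1 by (intro mult_right_mono[OF \<rho>43] mult_nonneg_nonneg; simp)+
  qed
  have abs\<Delta>: "\<bar>\<Delta> f\<bar> \<le> 3 * (k / d)" if "f \<in> A" for f
    using lin[OF that] q by (simp add: \<Delta>_eq abs_le_iff)
  \<comment> \<open>One factor is bounded by its worst case \<open>3 * (k / d)\<close> and the other
    kept, so that the sum of squares still carries the factor \<open>q * a\<close>.\<close>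
  have sq\<Delta>: "(\<Delta> f)\<^sup>2 \<le> 3 * (k / d) * ((8 / 3) * q + (4 / 3) * (l f / d))" if "f \<in> A" for f
  proof -
    have "\<bar>\<Delta> f\<bar> \<le> (8 / 3) * q + (4 / 3) * (l f / d)"
      using lin[OF that] q(1) by (simp add: \<Delta>_eq abs_le_iff)
    then have "\<bar>\<Delta> f\<bar> * \<bar>\<Delta> f\<bar> \<le> 3 * (k / d) * ((8 / 3) * q + (4 / 3) * (l f / d))"
      using abs\<Delta>[OF that] k d by (intro mult_mono) auto
    then show ?thesis
      by (simp add: power2_eq_square)
  qed
  have "(\<Sum>f\<in>A. (\<Delta> f)\<^sup>2) \<le> (\<Sum>f\<in>A. 3 * (k / d) * ((8 / 3) * q + (4 / 3) * (l f / d)))"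
    by (intro sum_mono sq\<Delta>)
  also have "\<dots> = 3 * (k / d) * ((8 / 3) * (a * q) + (4 / 3) * (\<tau> + g * a * q))"
    by (simp only: sum_distrib_left[symmetric] sum.distrib sum_constant a_def[symmetric] sum_ld)
  also have "\<dots> \<le> 3 * (k / d) * (64 / 3 * (q * a))"
  proof (intro mult_left_mono)
    have "8 * \<epsilon> * q * a \<le> 8 * (1/4) * q * a"
      using \<epsilon> q a0 by (intro mult_right_mono) auto
    then have "\<tau> \<le> 2 * (q * a)"
      using \<tau> by (simp add: abs_le_iff algebra_simps)
    moreover have "0 \<le> q * a"
      using q a0 by simp
    ultimately show "(8 / 3) * (a * q) + (4 / 3) * (\<tau> + g * a * q) \<le> 64 / 3 * (q * a)"
      using gaq by (simp add: algebra_simps)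
  qed (use k d in auto)
  finally have sumsq: "(\<Sum>f\<in>A. (\<Delta> f)\<^sup>2) \<le> 64 * (k / d) * (q * a)"
    by (simp add: ac_simps)
  have \<theta>kd: "64 * (k / d) * \<theta> \<le> \<epsilon>"
    using \<theta>(2) d by (simp add: field_simps)
  \<comment> \<open>The final constant 19 is 18 from the mean drift plus 1 from the quadratic term,
    which the smallness of \<open>\<theta>\<close> brings down to that size.\<close>
  have "(\<Sum>f\<in>A. exp (s * \<theta> * \<Delta> f)) \<le> (\<Sum>f\<in>A. 1 + s * \<theta> * \<Delta> f + \<theta>\<^sup>2 * (\<Delta> f)\<^sup>2)"
  proof (rule sum_mono)
    fix f assume f: "f \<in> A"
    have "\<theta> * \<bar>\<Delta> f\<bar> \<le> \<theta> * (3 * (k / d))"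
      using abs\<Delta>[OF f] \<theta>(1) by (intro mult_left_mono)
    also have "\<dots> \<le> 64 * (k / d) * \<theta>"
      using \<theta>(1) k d by (simp add: field_simps)
    also have "\<dots> \<le> 1"
      using \<theta>kd \<epsilon> by simp
    finally have "\<bar>s * \<theta> * \<Delta> f\<bar> \<le> 1"
      using s \<theta>(1) by (simp add: abs_mult)
    moreover have "s\<^sup>2 = 1"
      using s by (metis power2_abs one_power2)
    ultimately show "exp (s * \<theta> * \<Delta> f) \<le> 1 + s * \<theta> * \<Delta> f + \<theta>\<^sup>2 * (\<Delta> f)\<^sup>2"
      using exp_le_quadratic[of "s * \<theta> * \<Delta> f"] by (simp add: power_mult_distrib)
  qed
  also have "\<dots> = a + s * \<theta> * sum \<Delta> A + \<theta>\<^sup>2 * (\<Sum>f\<in>A. (\<Delta> f)\<^sup>2)"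
    by (simp add: sum.distrib sum_distrib_left a_def)
  also have "\<dots> \<le> a + \<theta> * (18 * (\<epsilon> * q * a)) + \<theta> * (\<epsilon> * (q * a))"
  proof (intro add_mono order_refl)
    have "s * \<theta> * sum \<Delta> A \<le> \<bar>s * \<theta> * sum \<Delta> A\<bar>" by simp
    also have "\<dots> = \<theta> * \<bar>sum \<Delta> A\<bar>"
      using s \<theta>(1) by (simp add: abs_mult)
    also have "\<dots> \<le> \<theta> * (18 * (\<epsilon> * q * a))"
      using mean\<Delta> \<theta>(1) by (intro mult_left_mono)
    finally show "s * \<theta> * sum \<Delta> A \<le> \<theta> * (18 * (\<epsilon> * q * a))" .
    have "\<theta>\<^sup>2 * (\<Sum>f\<in>A. (\<Delta> f)\<^sup>2) \<le> \<theta>\<^sup>2 * (64 * (k / d) * (q * a))"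
      using sumsq by (intro mult_left_mono) auto
    also have "\<dots> = \<theta> * ((64 * (k / d) * \<theta>) * (q * a))"
      by (simp add: power2_eq_square)
    also have "\<dots> \<le> \<theta> * (\<epsilon> * (q * a))"
      using \<theta>kd \<theta>(1) q a0 by (intro mult_left_mono mult_right_mono) auto
    finally show "\<theta>\<^sup>2 * (\<Sum>f\<in>A. (\<Delta> f)\<^sup>2) \<le> \<theta> * (\<epsilon> * (q * a))" .
  qed
  also have "\<dots> = a * (1 + 19 * \<theta> * \<epsilon> * q)"
    by (simp add: algebra_simps)
  also have "\<dots> \<le> a * exp (19 * \<theta> * \<epsilon> * q)"
    using a0 exp_ge_add_one_self by (intro mult_left_mono) auto
  finally show ?thesis
    by (simp add: \<Delta>_def a_def)
qed

text \<open>Bernoulli's inequality for \<open>y\<close> and for \<open>- y\<close>. With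
  \<open>y\<close> the fraction of the uncovered vertices that one edge covers and
  \<open>j = k - 1\<close>, the power is the factor by which \<open>mean_deg\<close>
  shrinks.\<close>

lemma power_inverse_bounds:
  fixes y :: real
  assumes "0 \<le> y" "y < 1"
  shows "1 + real j * y \<le> (1 / (1 - y)) ^ j" "(1 / (1 - y)) ^ j * (1 - real j * y) \<le> 1"
proof -
  have "1 + y \<le> 1 / (1 - y)"
    using assms by (simp add: field_simps)
  then have "(1 + y) ^ j \<le> (1 / (1 - y)) ^ j"
    using assms by (intro power_mono) auto
  moreover have "1 + real j * y \<le> (1 + y) ^ j"
    using Bernoulli_inequality[of y j] assms by (simp add: mult.commute)
  ultimately show "1 + real j * y \<le> (1 / (1 - y)) ^ j"
    by linarith
  have "1 - real j * y \<le> (1 - y) ^ j"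
    using Bernoulli_inequality[of "- y" j] assms by (simp add: mult.commute)
  then have "(1 / (1 - y)) ^ j * (1 - real j * y) \<le> (1 / (1 - y)) ^ j * (1 - y) ^ j"
    using assms by (intro mult_left_mono) auto
  also have "\<dots> = 1"
    using assms by (simp flip: power_mult_distrib)
  finally show "(1 / (1 - y)) ^ j * (1 - real j * y) \<le> 1" .
qed

section \<open>The potential of the degree errors is a supermartingale\<close>

context linear_hypergraph
begin

definition left :: "nat \<Rightarrow> real" where
  "left i = real (card V) - real i * real k"

text \<open>The heuristic degree: an edge at an uncovered vertex stays available when its other
  \<open>k - 1\<close> points are uncovered, as if independently.\<close>

definition mean_deg :: "nat \<Rightarrow> real" where
  "mean_deg i = real D * (left i / real (card V)) ^ (k - 1)"

text \<open>Tolerance for the relative degree error. The exponent is chosen so that its growth in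
  each step absorbs the drift rate 19 of \<open>sum_exp_drift_le\<close>.\<close>

definition err :: "real \<Rightarrow> nat \<Rightarrow> real" where
  "err \<epsilon> i = \<epsilon> * (real (card V) / left i) ^ (19 * k)"

definition potential :: "real \<Rightarrow> real \<Rightarrow> nat \<Rightarrow> 'v set set \<Rightarrow> real" where
  "potential \<epsilon> \<theta> i M = (\<Sum>v\<in>uncovered M.
     exp (\<theta> * ((real (deg M v) / mean_deg i - 1) - err \<epsilon> i)) +
     exp (\<theta> * (- (real (deg M v) / mean_deg i - 1) - err \<epsilon> i)))"

lemma card_uncovered_left: "M \<in> matchings i \<Longrightarrow> real (card (uncovered M)) = left i"
  using arg_cong[OF card_uncovered[of M i], of real] by (simp add: left_def)

lemma potential_nonneg: "0 \<le> potential \<epsilon> \<theta> i M"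
  unfolding potential_def by (intro sum_nonneg) auto

text \<open>All summands are positive, so a total below 1 forces every exponent, for both signs of
  the error, to be negative.\<close>

lemma deg_close_if_potential:
  assumes "potential \<epsilon> \<theta> i M < 1" "0 < \<theta>" "v \<in> uncovered M"
  shows "\<bar>real (deg M v) / mean_deg i - 1\<bar> < err \<epsilon> i"
proof -
  let ?z = "real (deg M v) / mean_deg i - 1"
  have "exp (\<theta> * (?z - err \<epsilon> i)) + exp (\<theta> * (- ?z - err \<epsilon> i)) \<le> potential \<epsilon> \<theta> i M"
    unfolding potential_def using assms(3) finite_uncovered
    by (intro member_le_sum[where f = "\<lambda>v. exp (\<theta> * ((real (deg M v) / mean_deg i - 1) - err \<epsilon> i)) +
     exp (\<theta> * (- (real (deg M v) / mean_deg i - 1) - err \<epsilon> i))"]) auto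
  then have "exp (\<theta> * (?z - err \<epsilon> i)) < 1" "exp (\<theta> * (- ?z - err \<epsilon> i)) < 1"
    using assms(1) exp_gt_zero[of "\<theta> * (?z - err \<epsilon> i)"] exp_gt_zero[of "\<theta> * (- ?z - err \<epsilon> i)"]
    by linarith+
  then have "?z - err \<epsilon> i < 0" "- ?z - err \<epsilon> i < 0"
    using assms(2) by (auto simp: mult_less_0_iff)
  then show ?thesis
    by linarith
qed

text \<open>Handshake count: \<open>k * card (avail M)\<close> is the sum of the degrees of the
  \<open>left i\<close> uncovered vertices.\<close>

lemma card_avail_bounds:
  assumes M: "M \<in> matchings i" and pos: "0 < left i"
    and close: "\<And>v. v \<in> uncovered M \<Longrightarrow> \<bar>real (deg M v) / mean_deg i - 1\<bar> \<le> \<epsilon>"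
  shows "left i * mean_deg i * (1 - \<epsilon>) \<le> real k * real (card (avail M))"
    and "real k * real (card (avail M)) \<le> left i * mean_deg i * (1 + \<epsilon>)"
proof -
  have m: "0 < mean_deg i"
    using pos card_V_pos D_pos by (simp add: mean_deg_def)
  have d: "mean_deg i * (1 - \<epsilon>) \<le> real (deg M v)" "real (deg M v) \<le> mean_deg i * (1 + \<epsilon>)"
    if "v \<in> uncovered M" for v
    using close[OF that] m by (auto simp: abs_le_iff field_simps)
  have "real k * real (card (avail M)) = (\<Sum>v\<in>uncovered M. real (deg M v))"
    using arg_cong[OF sum_deg[of M], of real] by simp
  moreover have "(\<Sum>v\<in>uncovered M. real (deg M v)) \<le> (\<Sum>v\<in>uncovered M. mean_deg i * (1 + \<epsilon>))"
    "(\<Sum>v\<in>uncovered M. mean_deg i * (1 - \<epsilon>)) \<le> (\<Sum>v\<in>uncovered M. real (deg M v))"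
    by (intro sum_mono d; assumption)+
  ultimately show "left i * mean_deg i * (1 - \<epsilon>) \<le> real k * real (card (avail M))"
    and "real k * real (card (avail M)) \<le> left i * mean_deg i * (1 + \<epsilon>)"
    using card_uncovered_left[OF M] by (simp_all add: algebra_simps)
qed

lemma sum_loss_bounds:
  assumes v: "v \<in> uncovered M"
    and lo: "\<And>w. w \<in> uncovered M \<Longrightarrow> lo \<le> real (deg M w)"
    and hi: "\<And>w. w \<in> uncovered M \<Longrightarrow> real (deg M w) \<le> hi"
  shows "real (deg M v) * (real k - 1) * (lo - 1) \<le> (\<Sum>f\<in>avail M. real (loss M v f))"
    and "(\<Sum>f\<in>avail M. real (loss M v f)) \<le> real (deg M v) * (real k - 1) * hi"
proof -
  let ?E = "{e \<in> avail M. v \<in> e}"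
  have "(\<Sum>f\<in>avail M. real (loss M v f)) = real (\<Sum>f\<in>avail M. loss M v f)"
    by simp
  also have "\<dots> = (\<Sum>e\<in>?E. \<Sum>w\<in>e - {v}. real (deg M w - 1))"
    unfolding sum_loss by simp
  finally have eq: "(\<Sum>f\<in>avail M. real (loss M v f)) = \<dots>" .
  have ce: "real (card (e - {v})) = real k - 1" if "e \<in> ?E" for e
  proof -
    have "e \<in> H" "v \<in> e"
      using that avail_subset by auto
    then show ?thesis
      using edge_card[of e] finite_edge[of e] k_ge_2 by (simp add: card_Diff_singleton)
  qed
  \<comment> \<open>Truncation of \<open>deg M w - 1\<close> at degree 0 only raises the value, so
    the lower bound survives.\<close>
  have w: "lo - 1 \<le> real (deg M w - 1)" "real (deg M w - 1) \<le> hi" if "e \<in> ?E" "w \<in> e - {v}" for e w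
  proof -
    have "w \<in> uncovered M"
      using that avail_subset_uncovered by auto
    from lo[OF this] hi[OF this] show "lo - 1 \<le> real (deg M w - 1)" "real (deg M w - 1) \<le> hi"
      by linarith+
  qed
  have "(\<Sum>e\<in>?E. \<Sum>w\<in>e - {v}. lo - 1) \<le> (\<Sum>e\<in>?E. \<Sum>w\<in>e - {v}. real (deg M w - 1))"
    "(\<Sum>e\<in>?E. \<Sum>w\<in>e - {v}. real (deg M w - 1)) \<le> (\<Sum>e\<in>?E. \<Sum>w\<in>e - {v}. hi)"
    by (intro sum_mono w; assumption)+
  moreover have "(\<Sum>e\<in>?E. \<Sum>w\<in>e - {v}. c) = real (deg M v) * (real k - 1) * c" for c :: real
  proof -
    have "(\<Sum>e\<in>?E. \<Sum>w\<in>e - {v}. c) = (\<Sum>e\<in>?E. (real k - 1) * c)"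
      by (intro sum.cong) (use ce in auto)
    then show ?thesis by (simp add: deg_def)
  qed
  ultimately show "real (deg M v) * (real k - 1) * (lo - 1) \<le> (\<Sum>f\<in>avail M. real (loss M v f))"
    and "(\<Sum>f\<in>avail M. real (loss M v f)) \<le> real (deg M v) * (real k - 1) * hi"
    by (simp_all add: eq)
qed

text \<open>For each vertex and sign the drift multiplies the mean exponential by at most
  \<open>exp (19 * \<theta> * e * q)\<close>, and the growth of the tolerance pays for this.
  Vertices covered by the new edge drop out of the sum.\<close>

lemma potential_step:
  assumes M: "M \<in> matchings i" and \<theta>: "0 < \<theta>" and small: "potential \<epsilon> \<theta> i M < 1"
    and \<epsilon>: "0 < \<epsilon>" "err \<epsilon> i \<le> 1 / 4"
    and left: "real k * mean_deg i \<le> left i" "real k < left i"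
    and mean: "real k \<le> err \<epsilon> i * mean_deg i" "64 * real k * \<theta> \<le> err \<epsilon> i * mean_deg i"
  shows "(\<Sum>f\<in>avail M. potential \<epsilon> \<theta> (Suc i) (insert f M)) \<le> real (card (avail M)) * potential \<epsilon> \<theta> i M"
proof -
  define u where "u = left i"
  define d where "d = mean_deg i"
  define e where "e = err \<epsilon> i"
  define a where "a = real (card (avail M))"
  \<comment> \<open>\<open>y\<close> is the share of the uncovered vertices that one edge takes,
    \<open>\<rho>\<close> the ratio of successive mean degrees, and \<open>q\<close> its excess over
    1 to first order.\<close>
  define y where "y = real k / u"
  define q where "q = real (k - 1) * y"
  define \<rho> where "\<rho> = (1 / (1 - y)) ^ (k - 1)"
  have k2: "2 \<le> real k" and rk: "real (k - 1) = real k - 1"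
    using k_ge_2 by auto
  have u: "0 < u" "real k < u" and N: "0 < real (card V)"
    using left k2 card_V_pos by (auto simp: u_def)
  have d: "0 < d"
    using u N D_pos by (simp add: d_def mean_deg_def u_def[symmetric])
  have e: "0 < e" "e \<le> 1 / 4"
    using \<epsilon> u N by (auto simp: e_def err_def u_def[symmetric])
  have y: "0 < y" "y < 1"
    using u k2 by (auto simp: y_def)
  have u_Suc: "left (Suc i) = u * (1 - y)"
    using u by (simp add: u_def[symmetric] y_def field_simps) (simp add: u_def left_def algebra_simps)
  have d_Suc: "d / mean_deg (Suc i) = \<rho>"
    using u N y D_pos
    by (simp add: d_def mean_deg_def u_Suc u_def[symmetric] \<rho>_def power_mult_distrib power_divide)
  have d_Suc_pos: "0 < mean_deg (Suc i)"
    using u N y D_pos by (simp add: mean_deg_def u_Suc)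
  have q0: "0 \<le> q"
    using y by (simp add: q_def)
  have qkd: "q \<le> real k / d"
  proof -
    have "q * d \<le> real k * y * d"
      using y d k2 by (intro mult_right_mono) (auto simp: q_def rk)
    also have "\<dots> = real k * ((real k * d) / u)"
      by (simp add: y_def)
    also have "\<dots> \<le> real k * 1"
      using left(1) u by (intro mult_left_mono) (auto simp: u_def d_def)
    finally show ?thesis
      using d by (simp add: field_simps)
  qed
  have qe: "q \<le> e"
  proof -
    have "real k / d \<le> e"
      using mean(1) d by (simp add: e_def d_def field_simps)
    then show ?thesis
      using qkd by linarith
  qed
  have \<rho>: "1 + q \<le> \<rho>" "\<rho> * (1 - q) \<le> 1"
    using power_inverse_bounds[of y "k - 1"] y by (auto simp: \<rho>_def q_def)
  have e_Suc: "e + 19 * e * q \<le> err \<epsilon> (Suc i)"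
  proof -
    have "err \<epsilon> (Suc i) = e * (1 / (1 - y)) ^ (19 * k)"
      using u y by (simp add: err_def e_def u_Suc u_def[symmetric] power_mult_distrib power_divide)
    also have "\<dots> \<ge> e * (1 + real (19 * k) * y)"
      using power_inverse_bounds(1)[of y "19 * k"] y e by (intro mult_left_mono) auto
    also have "e * (1 + real (19 * k) * y) \<ge> e + 19 * e * q"
    proof -
      have "q \<le> real k * y"
        using y by (simp add: q_def rk)
      then have "19 * e * q \<le> 19 * e * (real k * y)"
        using e by (intro mult_left_mono) auto
      then show ?thesis by (simp add: algebra_simps)
    qed
    finally show ?thesis .
  qed
  define g where "g v = real (deg M v) / d" for v
  have g: "\<bar>g v - 1\<bar> \<le> e" if "v \<in> uncovered M" for v
    using deg_close_if_potential[OF small \<theta> that] by (simp add: g_def d_def e_def)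
  have dg: "real (deg M v) = g v * d" for v
    using d by (simp add: g_def)
  have a_bounds: "u * d * (1 - e) \<le> real k * a" "real k * a \<le> u * d * (1 + e)"
    using card_avail_bounds[OF M, of e] u g by (auto simp: u_def d_def a_def g_def)
  have ed: "1 \<le> e * d"
    using mean(1) k2 by (simp add: e_def d_def)
  \<comment> \<open>The prediction is \<open>g v * (k - 1) * b\<close> with
    \<open>b = k * a / u\<close>, and \<open>b\<close> is \<open>d\<close> up to factors
    \<open>1 - e\<close> and \<open>1 + e\<close>. The slack \<open>4 * e\<close> covers this, the
    same error in the other degrees, and the \<open>- 1\<close> for the edge itself, because
    \<open>1 \<le> e * d\<close>.\<close>
  have mean_loss: "\<bar>(\<Sum>f\<in>avail M. real (loss M v f)) / d - g v * a * q\<bar> \<le> 4 * e * (g v * a * q)"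
    if v: "v \<in> uncovered M" for v
  proof -
    let ?S = "\<Sum>f\<in>avail M. real (loss M v f)"
    have lo: "d * (1 - e) \<le> real (deg M w)" and hi: "real (deg M w) \<le> d * (1 + e)"
      if "w \<in> uncovered M" for w
      using g[OF that] d by (auto simp: g_def abs_le_iff field_simps)
    have S: "real (deg M v) * (real k - 1) * (d * (1 - e) - 1) \<le> ?S"
      "?S \<le> real (deg M v) * (real k - 1) * (d * (1 + e))"
      using sum_loss_bounds[OF v lo hi] by auto
    have gv: "0 \<le> g v"
      using d by (simp add: g_def)
    have aq: "a * q = (real k - 1) * (real k * a / u)"
      unfolding q_def rk y_def by simp
    have "u * d * (1 - e) / u \<le> real k * a / u" "real k * a / u \<le> u * d * (1 + e) / u"
      using a_bounds u by (intro divide_right_mono; simp)+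
    then have au: "d * (1 - e) \<le> real k * a / u" "real k * a / u \<le> d * (1 + e)"
      using u by simp_all
    define b where "b = real k * a / u"
    have "(1 - 4 * e) * b \<le> (1 - 4 * e) * (d * (1 + e))"
      using au(2) e by (intro mult_left_mono) (auto simp: b_def)
    also have "\<dots> = d - 3 * (e * d) - 4 * e * e * d"
      by (simp add: algebra_simps)
    also have "\<dots> \<le> d * (1 - e) - 1"
    proof -
      have "0 \<le> 4 * e * e * d"
        using e d by simp
      then show ?thesis
        using ed by (simp add: algebra_simps)
    qed
    finally have b1: "(1 - 4 * e) * b \<le> d * (1 - e) - 1" .
    have "d * (1 + e) \<le> d * ((1 + 4 * e) * (1 - e))"
    proof (intro mult_left_mono)
      have "e * e \<le> e * (1/4)"
        using e by (intro mult_left_mono) auto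
      then have "4 * (e * e) \<le> 2 * e"
        using e by simp
      then show "1 + e \<le> (1 + 4 * e) * (1 - e)"
        by (simp add: algebra_simps)
    qed (use d in auto)
    also have "\<dots> = (1 + 4 * e) * (d * (1 - e))"
      by simp
    also have "\<dots> \<le> (1 + 4 * e) * b"
      using au(1) e by (intro mult_left_mono) (auto simp: b_def)
    finally have b2: "d * (1 + e) \<le> (1 + 4 * e) * b" .
    have gk: "0 \<le> g v * (real k - 1)"
      using gv k2 by simp
    have "?S / d \<le> g v * (real k - 1) * (d * (1 + e))"
      using S(2) d by (simp add: dg field_simps)
    also have "\<dots> \<le> g v * (real k - 1) * ((1 + 4 * e) * b)"
      using b2 gk by (rule mult_left_mono)
    also have "\<dots> = g v * a * q + 4 * e * (g v * a * q)"
    proof -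
      have "g v * a * q = g v * (real k - 1) * b"
        using aq by (simp add: b_def mult.assoc)
      show ?thesis
        unfolding \<open>g v * a * q = g v * (real k - 1) * b\<close> by (simp add: algebra_simps)
    qed
    finally have up: "?S / d \<le> g v * a * q + 4 * e * (g v * a * q)" .
    have "g v * a * q - 4 * e * (g v * a * q) = g v * (real k - 1) * ((1 - 4 * e) * b)"
    proof -
      have "g v * a * q = g v * (real k - 1) * b"
        using aq by (simp add: b_def mult.assoc)
      show ?thesis
        unfolding \<open>g v * a * q = g v * (real k - 1) * b\<close> by (simp add: algebra_simps)
    qed
    also have "\<dots> \<le> g v * (real k - 1) * (d * (1 - e) - 1)"
      using b1 gk by (rule mult_left_mono)
    also have "\<dots> \<le> ?S / d"
      using S(1) d by (simp add: dg field_simps)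
    finally show ?thesis
      using up by (simp add: abs_le_iff)
  qed
  have drift: "(\<Sum>f\<in>avail M. exp (s * \<theta> * (\<rho> * (g v - real (loss M v f) / d) - g v)))
      \<le> a * exp (19 * \<theta> * e * q)" if v: "v \<in> uncovered M" and s: "\<bar>s\<bar> = 1" for v s
    unfolding a_def
  proof (rule sum_exp_drift_le[where k = "real k"])
    show "real (loss M v f) \<le> real k" if "f \<in> avail M" for f
      using that avail_subset[of M] by (auto intro: loss_le)
    show "64 * real k * \<theta> \<le> e * d"
      using mean(2) by (simp add: e_def d_def)
    show "0 \<le> g v" "g v \<le> 2"
      using g[OF v] e d by (auto simp: g_def)
    show "\<bar>(\<Sum>f\<in>avail M. real (loss M v f)) / d - g v * real (card (avail M)) * q\<bar>
        \<le> 4 * e * (g v * real (card (avail M)) * q)"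
      using mean_loss[OF v] by (simp add: a_def)
  qed (use finite_avail d q0 qe qkd e \<rho> \<theta> s in auto)
  define e' where "e' = err \<epsilon> (Suc i)"
  \<comment> \<open>The summand of the next potential for the sign \<open>s\<close>. It is also
    defined and positive for \<open>v \<in> f\<close>, so the sum can be enlarged to all of
    \<open>uncovered M\<close>.\<close>
  define F where "F s v f = exp (\<theta> * (s * (\<rho> * (g v - real (loss M v f) / d) - 1) - e'))" for s v f
  have sumF: "(\<Sum>f\<in>avail M. F s v f) \<le> a * exp (\<theta> * (s * (g v - 1) - e))"
    if v: "v \<in> uncovered M" and s: "\<bar>s\<bar> = 1" for v s
  proof -
    have "(\<Sum>f\<in>avail M. F s v f) = exp (\<theta> * (s * (g v - 1) - e')) *
        (\<Sum>f\<in>avail M. exp (s * \<theta> * (\<rho> * (g v - real (loss M v f) / d) - g v)))"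
      unfolding sum_distrib_left F_def
      by (intro sum.cong) (auto simp: algebra_simps simp flip: exp_add)
    also have "\<dots> \<le> exp (\<theta> * (s * (g v - 1) - e')) * (a * exp (19 * \<theta> * e * q))"
      using drift[OF v s] by (intro mult_left_mono) auto
    also have "\<dots> = a * exp (\<theta> * (s * (g v - 1) - (e' - 19 * e * q)))"
      by (simp add: algebra_simps flip: exp_add)
    also have "\<dots> \<le> a * exp (\<theta> * (s * (g v - 1) - e))"
      using e_Suc \<theta> by (intro mult_left_mono) (auto simp: e'_def a_def)
    finally show ?thesis .
  qed
  have "potential \<epsilon> \<theta> (Suc i) (insert f M) \<le> (\<Sum>v\<in>uncovered M. F 1 v f + F (-1) v f)"
    if f: "f \<in> avail M" for f
  proof -
    have eq: "real (deg (insert f M) v) / mean_deg (Suc i) = \<rho> * (g v - real (loss M v f) / d)"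
      if "v \<in> uncovered M - f" for v
    proof -
      have "real (deg M v) = real (deg (insert f M) v) + real (loss M v f)"
        using deg_insert[of v f M] that by (metis DiffD2 of_nat_add)
      then show ?thesis
        using d d_Suc_pos by (simp add: d_Suc[symmetric] g_def field_simps)
    qed
    have "potential \<epsilon> \<theta> (Suc i) (insert f M) = (\<Sum>v\<in>uncovered M - f. F 1 v f + F (-1) v f)"
      unfolding potential_def uncovered_insert
      by (intro sum.cong refl) (simp add: eq F_def e'_def)
    also have "\<dots> \<le> (\<Sum>v\<in>uncovered M. F 1 v f + F (-1) v f)"
      by (intro sum_mono2) (auto simp: finite_uncovered F_def add_nonneg_nonneg)
    finally show ?thesis .
  qed
  then have "(\<Sum>f\<in>avail M. potential \<epsilon> \<theta> (Suc i) (insert f M))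
      \<le> (\<Sum>f\<in>avail M. \<Sum>v\<in>uncovered M. F 1 v f + F (-1) v f)"
    by (intro sum_mono)
  also have "\<dots> = (\<Sum>v\<in>uncovered M. (\<Sum>f\<in>avail M. F 1 v f) + (\<Sum>f\<in>avail M. F (-1) v f))"
    by (subst sum.swap) (simp add: sum.distrib)
  also have "\<dots> \<le> (\<Sum>v\<in>uncovered M. a * exp (\<theta> * (1 * (g v - 1) - e)) + a * exp (\<theta> * ((-1) * (g v - 1) - e)))"
    by (intro sum_mono add_mono sumF) auto
  also have "\<dots> = a * potential \<epsilon> \<theta> i M"
    unfolding potential_def sum_distrib_left
    by (intro sum.cong refl) (simp add: g_def d_def e_def algebra_simps)
  finally show ?thesis
    by (simp add: a_def)
qed

end

text \<open>\<open>m ^ m / fact m\<close> is a single term of the series of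
  \<open>exp m\<close>.\<close>

lemma power_le_exp_fact: "real m ^ m \<le> exp (real m) * fact m"
proof -
  have "real m ^ m /\<^sub>R fact m \<le> (\<Sum>j. real m ^ j /\<^sub>R fact j)"
    using sum_le_suminf[OF summable_exp_generic[of "real m"], of "{m}"] by simp
  then show ?thesis
    by (simp add: exp_def field_simps)
qed

lemma ln_fact_ge: "real m * ln (real m) - real m \<le> ln (fact m)"
proof (cases "m = 0")
  case False
  then have "ln (real m ^ m) \<le> ln (exp (real m) * fact m)"
    using power_le_exp_fact[of m] by (subst ln_le_cancel_iff) auto
  then show ?thesis
    using False by (simp add: ln_mult ln_realpow)
qed simp

section \<open>Greedy counting of matchings\<close>

context linear_hypergraph
begin

lemma potential_0: "potential \<epsilon> \<theta> 0 {} = 2 * real (card V) * exp (- (\<theta> * \<epsilon>))"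
  using card_V_pos D_pos
  by (simp add: potential_def uncovered_def deg_def avail_def degree mean_deg_def left_def err_def)

text \<open>Clipping at 0 discards matchings with large potential, and no weight exceeds 1, so this
  is a lower bound for the number of matchings that obeys a recursion.\<close>

definition greedy_weight :: "real \<Rightarrow> real \<Rightarrow> nat \<Rightarrow> real" where
  "greedy_weight \<epsilon> \<theta> i = (\<Sum>M\<in>matchings i. max 0 (1 - potential \<epsilon> \<theta> i M))"

lemma greedy_weight_le: "greedy_weight \<epsilon> \<theta> i \<le> real (card (matchings i))"
proof -
  have "greedy_weight \<epsilon> \<theta> i \<le> (\<Sum>M\<in>matchings i. 1)"
    unfolding greedy_weight_def using potential_nonneg by (intro sum_mono) auto
  then show ?thesis by simp
qed

text \<open>A matching of positive weight has controlled degrees, hence many available edges, and by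
  \<open>potential_step\<close> the average weight of its one-edge extensions is at least its
  own.\<close>

lemma greedy_weight_Suc:
  assumes \<theta>: "0 < \<theta>" and \<epsilon>: "0 < \<epsilon>" "err \<epsilon> i \<le> 1 / 4"
    and left: "real k * mean_deg i \<le> left i" "real k < left i"
    and mean: "real k \<le> err \<epsilon> i * mean_deg i" "64 * real k * \<theta> \<le> err \<epsilon> i * mean_deg i"
  shows "left i * mean_deg i * (1 - err \<epsilon> i) / real k * greedy_weight \<epsilon> \<theta> i
    \<le> (real i + 1) * greedy_weight \<epsilon> \<theta> (Suc i)"
proof -
  let ?c = "left i * mean_deg i * (1 - err \<epsilon> i) / real k"
  have kpos: "0 < real k"
    using k_ge_2 by simp
  have "?c * max 0 (1 - potential \<epsilon> \<theta> i M)
      \<le> (\<Sum>f\<in>avail M. max 0 (1 - potential \<epsilon> \<theta> (Suc i) (insert f M)))"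
    if M: "M \<in> matchings i" for M
  proof (cases "potential \<epsilon> \<theta> i M < 1")
    case True
    have "?c \<le> real (card (avail M))"
      using card_avail_bounds(1)[OF M, of "err \<epsilon> i"] deg_close_if_potential[OF True \<theta>] left kpos
      by (auto simp: field_simps less_imp_le)
    then have "?c * (1 - potential \<epsilon> \<theta> i M) \<le> real (card (avail M)) * (1 - potential \<epsilon> \<theta> i M)"
      using True by (intro mult_right_mono) auto
    also have "\<dots> \<le> (\<Sum>f\<in>avail M. 1 - potential \<epsilon> \<theta> (Suc i) (insert f M))"
      using potential_step[OF M \<theta> True \<epsilon> left mean] by (simp add: sum_subtractf algebra_simps)
    also have "\<dots> \<le> (\<Sum>f\<in>avail M. max 0 (1 - potential \<epsilon> \<theta> (Suc i) (insert f M)))"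
      by (intro sum_mono) auto
    finally show ?thesis
      using True by simp
  next
    case False
    then show ?thesis
      by (auto intro: sum_nonneg)
  qed
  then have "?c * greedy_weight \<epsilon> \<theta> i
      \<le> (\<Sum>M\<in>matchings i. \<Sum>f\<in>avail M. max 0 (1 - potential \<epsilon> \<theta> (Suc i) (insert f M)))"
    unfolding greedy_weight_def sum_distrib_left by (intro sum_mono)
  also have "\<dots> = (real i + 1) * greedy_weight \<epsilon> \<theta> (Suc i)"
    unfolding greedy_weight_def by (rule sum_matchings_Suc)
  finally show ?thesis .
qed

text \<open>The recursion bounds \<open>fact m * card (matchings m)\<close> below by half a product
  of step counts. The assumptions on \<open>\<delta>\<close> keep mean degree, tolerance and number
  of uncovered vertices in range for all \<open>m\<close> steps.\<close>

lemma ln_card_matchings_ge: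
  fixes \<epsilon> \<theta> \<delta> \<eta> :: real
  assumes \<theta>: "0 < \<theta>" and \<epsilon>: "0 < \<epsilon>" and \<delta>: "0 < \<delta>"
    and m: "\<delta> * real (card V) \<le> left m"
    and N: "real k * real D \<le> real (card V)" "2 * real k \<le> \<delta> * real (card V)"
    and \<eta>: "\<epsilon> / \<delta> ^ (19 * k) \<le> \<eta>" "\<eta> \<le> 1 / 4"
    and mean: "real k \<le> \<epsilon> * (real D * \<delta> ^ (k - 1))" "64 * real k * \<theta> \<le> \<epsilon> * (real D * \<delta> ^ (k - 1))"
    and start: "4 * real (card V) * exp (- (\<theta> * \<epsilon>)) \<le> 1"
  shows "real m * (ln (real D) + 1 - real k + ln (1 - \<eta>)) - ln 2 \<le> ln (real (card (matchings m)))"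
proof -
  define P where "P = real (card V) / real k"
  have kpos: "0 < real k" and k2: "2 \<le> real k" and Npos: "0 < real (card V)" and Dpos: "0 < real D"
    using k_ge_2 card_V_pos D_pos by auto
  have Ppos: "0 < P"
    using kpos Npos by (simp add: P_def)
  have left_P: "left i = real k * (P - real i)" for i
    using kpos by (simp add: left_def P_def algebra_simps)
  have mP: "real m < P"
  proof -
    have "0 < left m"
      using m \<delta> Npos by (smt (verit) mult_pos_pos)
    then show ?thesis
      using kpos by (simp add: left_P zero_less_mult_iff)
  qed
  \<comment> \<open>The true fraction of uncovered vertices is \<open>1 - i / P\<close>. As
    \<open>m < P\<close>, replacing \<open>P\<close> by \<open>m\<close> only lowers it, and the
    product over \<open>i\<close> becomes explicit in \<open>fact m / m ^ m\<close>.\<close>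
  define c where "c i = P * real D * (1 - real i / real m) ^ k * (1 - \<eta>)" for i
  have step: "c i * greedy_weight \<epsilon> \<theta> i \<le> (real i + 1) * greedy_weight \<epsilon> \<theta> (Suc i)" if im: "i < m" for i
  proof -
    have li: "left m \<le> left i"
      using im kpos by (simp add: left_P)
    define x where "x = left i / real (card V)"
    have x: "\<delta> \<le> x" "x \<le> 1"
      using m li Npos kpos by (simp_all add: x_def field_simps) (simp add: left_def)
    have x0: "0 < x"
      using x \<delta> by linarith
    have leftx: "left i = x * real (card V)"
      using Npos by (simp add: x_def)
    have mean_x: "mean_deg i = real D * x ^ (k - 1)"
      by (simp add: mean_deg_def x_def)
    have err_x: "err \<epsilon> i = \<epsilon> / x ^ (19 * k)"
      using Npos x0 by (simp add: err_def leftx power_divide)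
    have xk: "x ^ (k - 1) \<le> x"
      using power_decreasing[of 1 "k - 1" x] x x0 k_ge_2 by simp
    have err_le: "err \<epsilon> i \<le> \<eta>"
    proof -
      have "\<epsilon> / x ^ (19 * k) \<le> \<epsilon> / \<delta> ^ (19 * k)"
        using x \<delta> \<epsilon> by (intro divide_left_mono power_mono mult_pos_pos) auto
      then show ?thesis
        using \<eta>(1) err_x by linarith
    qed
    have err_ge: "\<epsilon> \<le> err \<epsilon> i"
    proof -
      have "x ^ (19 * k) \<le> 1"
        using x x0 by (intro power_le_one) auto
      then show ?thesis
        using \<epsilon> x0 by (simp add: err_x field_simps)
    qed
    have mean_ge: "real D * \<delta> ^ (k - 1) \<le> mean_deg i"
      using x \<delta> by (auto simp: mean_x intro!: mult_left_mono power_mono)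
    have em: "\<epsilon> * (real D * \<delta> ^ (k - 1)) \<le> err \<epsilon> i * mean_deg i"
      using err_ge mean_ge \<epsilon> \<delta> by (intro mult_mono) auto
    have "real k * mean_deg i \<le> real k * (real D * x)"
      unfolding mean_x using xk by (intro mult_left_mono) auto
    also have "\<dots> = (real k * real D) * x"
      by simp
    also have "\<dots> \<le> real (card V) * x"
      using N(1) x0 by (intro mult_right_mono) auto
    finally have l1: "real k * mean_deg i \<le> left i"
      by (simp add: leftx mult.commute)
    have l2: "real k < left i"
      using N(2) m li kpos by linarith
    have "c i \<le> left i * mean_deg i * (1 - err \<epsilon> i) / real k"
    proof -
      have xP: "x = 1 - real i / P"
        using Ppos kpos Npos by (simp add: x_def left_P) (simp add: P_def field_simps)
      have "1 - real i / real m \<le> x"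
        unfolding xP using im mP by (simp add: frac_le)
      then have "(1 - real i / real m) ^ k * (1 - \<eta>) \<le> x ^ k * (1 - err \<epsilon> i)"
        using im err_le \<eta>(2) x0 by (intro mult_mono power_mono) auto
      then have "P * real D * ((1 - real i / real m) ^ k * (1 - \<eta>)) \<le> P * real D * (x ^ k * (1 - err \<epsilon> i))"
        using Ppos by (intro mult_left_mono) auto
      also have "P * real D * (x ^ k * (1 - err \<epsilon> i)) = left i * mean_deg i * (1 - err \<epsilon> i) / real k"
      proof -
        have "x ^ k = x * x ^ (k - 1)"
          using k_ge_2 by (simp add: power_eq_if)
        then show ?thesis
          unfolding leftx mean_x P_def by simp
      qed
      finally show ?thesis
        by (simp add: c_def mult.assoc)
    qed
    moreover have "0 \<le> greedy_weight \<epsilon> \<theta> i"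
      unfolding greedy_weight_def by (intro sum_nonneg) auto
    ultimately have "c i * greedy_weight \<epsilon> \<theta> i
        \<le> left i * mean_deg i * (1 - err \<epsilon> i) / real k * greedy_weight \<epsilon> \<theta> i"
      by (intro mult_right_mono)
    also have "\<dots> \<le> (real i + 1) * greedy_weight \<epsilon> \<theta> (Suc i)"
      using err_le \<eta> em mean by (intro greedy_weight_Suc \<theta> \<epsilon> l1 l2) auto
    finally show ?thesis .
  qed
  have c_nonneg: "0 \<le> c i" if "i < m" for i
    using that Ppos \<eta>(2) by (auto simp: c_def intro!: mult_nonneg_nonneg)
  have iter: "(1 / 2) * (\<Prod>i<j. c i) \<le> fact j * greedy_weight \<epsilon> \<theta> j" if "j \<le> m" for j
    using that
  proof (induction j)
    case 0
    \<comment> \<open>By \<open>start\<close> the empty matching has potential at most 1/2.\<close>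
    have "greedy_weight \<epsilon> \<theta> 0 \<ge> 1 / 2"
      using start by (simp add: greedy_weight_def matchings_0 potential_0)
    then show ?case by simp
  next
    case (Suc j)
    have "(1 / 2) * (\<Prod>i<Suc j. c i) = c j * ((1 / 2) * (\<Prod>i<j. c i))"
      by simp
    also have "\<dots> \<le> c j * (fact j * greedy_weight \<epsilon> \<theta> j)"
      using Suc c_nonneg by (intro mult_left_mono) auto
    also have "\<dots> = fact j * (c j * greedy_weight \<epsilon> \<theta> j)"
      by simp
    also have "\<dots> \<le> fact j * ((real j + 1) * greedy_weight \<epsilon> \<theta> (Suc j))"
      using Suc.prems by (intro mult_left_mono step) auto
    finally show ?case
      by (simp add: algebra_simps)
  qed
  have prod_c: "(\<Prod>i<m. c i) = (P * real D * (1 - \<eta>)) ^ m * (fact m / real m ^ m) ^ k"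
  proof -
    have "(\<Prod>i<m. 1 - real i / real m) = (\<Prod>i<m. real (m - i) / real m)"
      by (intro prod.cong) (auto simp: field_simps of_nat_diff)
    also have "\<dots> = (\<Prod>i<m. real (m - i)) / real m ^ m"
      by (simp add: prod_dividef)
    also have "(\<Prod>i<m. real (m - i)) = fact m"
      by (simp add: fact_prod_rev atLeast0LessThan)
    finally have *: "(\<Prod>i<m. 1 - real i / real m) = fact m / real m ^ m" .
    have "(\<Prod>i<m. c i) = (\<Prod>i<m. (P * real D * (1 - \<eta>)) * (1 - real i / real m) ^ k)"
      by (intro prod.cong) (auto simp: c_def)
    also have "\<dots> = (P * real D * (1 - \<eta>)) ^ m * (\<Prod>i<m. 1 - real i / real m) ^ k"
      by (simp add: prod.distrib prod_power_distrib)
    finally show ?thesis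
      by (simp add: *)
  qed
  have pos: "0 < (P * real D * (1 - \<eta>)) ^ m * (fact m / real m ^ m) ^ k"
    using Ppos Dpos \<eta>(2) by (cases "m = 0") auto
  have "(1 / 2) * ((P * real D * (1 - \<eta>)) ^ m * (fact m / real m ^ m) ^ k)
      \<le> fact m * greedy_weight \<epsilon> \<theta> m"
    using iter[of m] by (simp add: prod_c)
  also have "\<dots> \<le> fact m * real (card (matchings m))"
    by (intro mult_left_mono greedy_weight_le) auto
  finally have main: "(1 / 2) * ((P * real D * (1 - \<eta>)) ^ m * (fact m / real m ^ m) ^ k)
      \<le> fact m * real (card (matchings m))" .
  then have "0 < (fact m :: real) * real (card (matchings m))"
    using pos by linarith
  then have Zpos: "0 < real (card (matchings m))"
    by (simp add: zero_less_mult_iff)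
  have "ln ((1 / 2) * ((P * real D * (1 - \<eta>)) ^ m * (fact m / real m ^ m) ^ k))
      \<le> ln (fact m * real (card (matchings m)))"
    using main pos by (subst ln_le_cancel_iff) auto
  also have "\<dots> = ln (fact m) + ln (real (card (matchings m)))"
    using Zpos by (simp add: ln_mult)
  also have "ln ((1 / 2) * ((P * real D * (1 - \<eta>)) ^ m * (fact m / real m ^ m) ^ k))
      = - ln 2 + real m * (ln P + ln (real D) + ln (1 - \<eta>)) + real k * (ln (fact m) - real m * ln (real m))"
  proof (cases "m = 0")
    case True
    then show ?thesis
      by (simp add: ln_div)
  next
    case False
    then show ?thesis
      using Ppos Dpos \<eta>(2) by (simp add: ln_mult ln_div ln_realpow)
  qed
  finally have A: "- ln 2 + real m * (ln P + ln (real D) + ln (1 - \<eta>)) + real k * (ln (fact m) - real m * ln (real m))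
     \<le> ln (fact m) + ln (real (card (matchings m)))" .
  \<comment> \<open>The product supplies \<open>k\<close> factorials and the orderings of the edges
    take one, so \<open>k - 1\<close> remain to be bounded.\<close>
  have B: "(real k - 1) * (real m * ln (real m) - real m) \<le> (real k - 1) * ln (fact m)"
    using ln_fact_ge[of m] k2 by (intro mult_left_mono) auto
  have C: "real m * ln (real m) \<le> real m * ln P"
    using mP by (cases "m = 0") (auto intro!: mult_left_mono)
  show ?thesis
    using A B C by (simp add: algebra_simps)
qed

end

section \<open>Upper bound for the number of matchings\<close>

text \<open>The quotient of the binomials is the probability that a random \<open>i\<close>-subset
  of \<open>m\<close> elements avoids \<open>j\<close> given ones. Removing one of
  \<open>n \<le> m\<close> elements costs a factor \<open>1 - i / n\<close>, which is at most
  \<open>1 - i / m\<close>.\<close>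

lemma binomial_diff_le:
  fixes m i j :: nat
  assumes "0 < m" "i \<le> m" "j \<le> m"
  shows "real ((m - j) choose i) \<le> real (m choose i) * (1 - real i / real m) ^ j"
  using assms(3)
proof (induction j)
  case (Suc j)
  define n where "n = m - j"
  have n: "0 < n" "n \<le> m" "m - Suc j = n - 1"
    using Suc.prems by (auto simp: n_def)
  have x: "0 \<le> 1 - real i / real m"
    using assms by simp
  have "real ((n - 1) choose i) \<le> real (n choose i) * (1 - real i / real m)"
  proof (cases "i \<le> n")
    case True
    have "(n - i) * (n choose i) = n * ((n - 1) choose i)"
      by (rule binomial_absorb_comp)
    then have "real (n - i) * real (n choose i) = real n * real ((n - 1) choose i)"
      by (metis of_nat_mult)
    then have "real ((n - 1) choose i) = real (n choose i) * (1 - real i / real n)"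
      using n True by (simp add: field_simps of_nat_diff)
    also have "\<dots> \<le> real (n choose i) * (1 - real i / real m)"
      using n by (intro mult_left_mono) (auto simp: frac_le)
    finally show ?thesis .
  next
    case False
    then have "(n - 1) choose i = 0" "n choose i = 0"
      by (auto simp: binomial_eq_0)
    then show ?thesis by (simp only: of_nat_0 mult_zero_left order_refl)
  qed
  also have "\<dots> \<le> real (m choose i) * (1 - real i / real m) ^ j * (1 - real i / real m)"
    using Suc x by (intro mult_right_mono) (auto simp: n_def)
  finally show ?case
    using n by (simp add: mult_ac)
qed simp

text \<open>Jensen's inequality for \<open>t * ln t\<close>, by the tangent at the mean
  \<open>c\<close>. It says that a distribution on \<open>A\<close> has entropy at most
  \<open>ln (card A)\<close>.\<close>

lemma sum_x_ln_x_ge: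
  fixes z :: "'a \<Rightarrow> real"
  assumes "finite A" "\<And>f. f \<in> A \<Longrightarrow> 0 \<le> z f" "0 < sum z A"
  shows "sum z A * ln (sum z A / real (card A)) \<le> (\<Sum>f\<in>A. z f * ln (z f))"
proof -
  have A: "0 < card A"
    using assms(1,3) by (auto simp: card_gt_0_iff)
  define c where "c = sum z A / real (card A)"
  have c: "0 < c"
    using assms(3) A by (simp add: c_def)
  have "z f * ln c + z f - c \<le> z f * ln (z f)" if "f \<in> A" for f
  proof (cases "z f = 0")
    case False
    then have z: "0 < z f"
      using assms(2)[OF that] by linarith
    have "ln (c / z f) \<le> c / z f - 1"
      using c z by (intro ln_le_minus_one) auto
    then have "z f * (ln c - ln (z f)) \<le> z f * (c / z f - 1)"
      using c z by (intro mult_left_mono) (auto simp: ln_div)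
    then show ?thesis
      using z by (simp add: algebra_simps)
  qed (use c in simp)
  then have "(\<Sum>f\<in>A. z f * ln c + z f - c) \<le> (\<Sum>f\<in>A. z f * ln (z f))"
    by (rule sum_mono)
  moreover have "(\<Sum>f\<in>A. z f * ln c + z f - c) = sum z A * ln c"
    using A by (simp add: sum_subtractf sum.distrib sum_distrib_right c_def)
  ultimately show ?thesis
    by (simp add: c_def)
qed

section \<open>Entropy of a random matching revealed edge by edge\<close>

context linear_hypergraph
begin

text \<open>For an i-matching \<open>I\<close>, dividing by
  \<open>card (matchings m) * (m choose i)\<close> gives the probability that the first
  \<open>i\<close> edges revealed from a uniformly random \<open>m\<close>-matching are those of
  \<open>I\<close>.\<close>

definition ext :: "nat \<Rightarrow> 'v set set \<Rightarrow> nat" where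
  "ext m I = card {M \<in> matchings m. I \<subseteq> M}"

lemma sub_matching:
  assumes "M \<in> matchings m" "I \<subseteq> M"
  shows "I \<in> matchings (card I)"
  using assms by (auto simp: matchings_def intro: pairwise_subset)

lemma sum_ext_mult:
  fixes g :: "'v set set \<Rightarrow> real"
  shows "(\<Sum>I\<in>matchings i. real (ext m I) * g I) = (\<Sum>M\<in>matchings m. \<Sum>I\<in>{I. I \<subseteq> M \<and> card I = i}. g I)"
proof -
  have "(\<Sum>I\<in>matchings i. real (ext m I) * g I)
      = (\<Sum>I\<in>matchings i. \<Sum>M\<in>matchings m. if I \<subseteq> M then g I else 0)"
    by (intro sum.cong refl) (simp add: ext_def sum.If_cases finite_matchings Int_def)
  also have "\<dots> = (\<Sum>M\<in>matchings m. \<Sum>I\<in>matchings i. if I \<subseteq> M then g I else 0)"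
    by (rule sum.swap)
  also have "\<dots> = (\<Sum>M\<in>matchings m. \<Sum>I\<in>{I. I \<subseteq> M \<and> card I = i}. g I)"
  proof (rule sum.cong[OF refl])
    fix M assume M: "M \<in> matchings m"
    have "{I \<in> matchings i. I \<subseteq> M} = {I. I \<subseteq> M \<and> card I = i}"
      using sub_matching[OF M] by (auto dest: matchingsD(3))
    then show "(\<Sum>I\<in>matchings i. if I \<subseteq> M then g I else 0) = (\<Sum>I\<in>{I. I \<subseteq> M \<and> card I = i}. g I)"
      by (simp add: sum.If_cases finite_matchings Int_def)
  qed
  finally show ?thesis .
qed

lemma sum_ext: "(\<Sum>I\<in>matchings i. real (ext m I)) = real (card (matchings m)) * real (m choose i)"
  using sum_ext_mult[of m "\<lambda>_. 1" i]
  by (simp add: n_subsets matchingsD(3,4))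

text \<open>Each \<open>m\<close>-matching containing \<open>I\<close> has \<open>m - i\<close>
  further edges, all of them available after \<open>I\<close>.\<close>

lemma sum_ext_insert:
  assumes I: "I \<in> matchings i" and "i \<le> m"
  shows "(\<Sum>f\<in>avail I. real (ext m (insert f I))) = (real m - real i) * real (ext m I)"
proof -
  let ?A = "{M \<in> matchings m. I \<subseteq> M}"
  have "(\<Sum>f\<in>avail I. ext m (insert f I)) = (\<Sum>f\<in>avail I. card {M \<in> ?A. f \<in> M})"
    unfolding ext_def by (intro sum.cong refl arg_cong[where f = card]) auto
  also have "\<dots> = (\<Sum>M\<in>?A. card (M \<inter> avail I))"
    by (rule sum_degrees) (auto simp: finite_matchings finite_avail)
  also have "\<dots> = (\<Sum>M\<in>?A. m - i)"
  proof (intro sum.cong refl)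
    fix M assume "M \<in> ?A"
    then have M: "M \<in> matchings m" "I \<subseteq> M" by auto
    have "f \<in> avail I" if "f \<in> M - I" for f
    proof -
      have "f \<inter> e = {}" if "e \<in> I" for e
      proof -
        have "disjnt f e"
          by (rule pairwiseD[OF matchingsD(2)[OF M(1)]]) (use \<open>f \<in> M - I\<close> that M(2) in auto)
        then show ?thesis
          by (simp add: disjnt_def)
      qed
      then show ?thesis
        using that matchingsD(1)[OF M(1)] by (auto simp: avail_def)
    qed
    then have "M \<inter> avail I = M - I"
      using avail_notin[of _ I] by auto
    then show "card (M \<inter> avail I) = m - i"
      using M matchingsD[OF M(1)] matchingsD[OF I] by (simp add: card_Diff_subset)
  qed
  finally have "(\<Sum>f\<in>avail I. ext m (insert f I)) = (m - i) * ext m I"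
    by (simp add: ext_def)
  then have "real (\<Sum>f\<in>avail I. ext m (insert f I)) = real ((m - i) * ext m I)"
    by (rule arg_cong)
  then show ?thesis
    using assms(2) by (simp add: of_nat_diff)
qed

text \<open>\<open>I\<close> must avoid the edges of \<open>M\<close> that meet \<open>f\<close>. If
  \<open>f\<close> is not in \<open>M\<close> and all its points are covered, linearity yields at
  least \<open>k\<close> such edges and hence the power \<open>k\<close>; otherwise one of the other
  two terms is at least 1 and the bound is trivial.\<close>

lemma card_avoiding_subsets:
  assumes M: "M \<in> matchings m" and "0 < m" "i \<le> m" and f: "f \<in> H"
  shows "real (card {I. I \<subseteq> M \<and> card I = i \<and> f \<inter> \<Union>I = {}})
    \<le> real (m choose i) * ((1 - real i / real m) ^ k + real (card (f \<inter> uncovered M)) + (if f \<in> M then 1 else 0))"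
proof -
  define x where "x = 1 - real i / real m"
  have x: "0 \<le> x" "x \<le> 1"
    using assms by (auto simp: x_def)
  define B where "B = {e \<in> M. e \<inter> f \<noteq> {}}"
  have finM: "finite M" and cM: "card M = m"
    using matchingsD[OF M] by auto
  have B: "B \<subseteq> M" "finite B" "card B \<le> m"
    using finM cM by (auto simp: B_def intro: card_mono)
  have "{I. I \<subseteq> M \<and> card I = i \<and> f \<inter> \<Union>I = {}} = {I. I \<subseteq> M - B \<and> card I = i}"
    by (auto simp: B_def)
  then have "card {I. I \<subseteq> M \<and> card I = i \<and> f \<inter> \<Union>I = {}} = card (M - B) choose i"
    using finM by (simp add: n_subsets)
  also have "card (M - B) = m - card B"
    using B finM cM by (simp add: card_Diff_subset)
  finally have "real (card {I. I \<subseteq> M \<and> card I = i \<and> f \<inter> \<Union>I = {}}) = real ((m - card B) choose i)"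
    by simp
  also have "\<dots> \<le> real (m choose i) * x ^ card B"
    unfolding x_def by (rule binomial_diff_le) (use assms B in auto)
  also have "\<dots> \<le> real (m choose i) * (x ^ k + real (card (f \<inter> uncovered M)) + (if f \<in> M then 1 else 0))"
  proof (intro mult_left_mono)
    have x1: "x ^ card B \<le> 1" "0 \<le> x ^ k"
      using x by (auto simp: power_le_one)
    show "x ^ card B \<le> x ^ k + real (card (f \<inter> uncovered M)) + (if f \<in> M then 1 else 0)"
    proof (cases "f \<in> M \<or> card (f \<inter> uncovered M) \<ge> 1")
      case True
      then show ?thesis
        using x1 by auto
    next
      case False
      then have "f \<notin> M" "card (f \<inter> uncovered M) = 0"
        by auto
      then have "f \<inter> uncovered M = {}"
        using finite_edge[OF f] by simp
      then have "f = (\<Union>e\<in>B. f \<inter> e)"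
        using edge_subset[OF f] unfolding uncovered_def B_def by blast
      then have "k = card (\<Union>e\<in>B. f \<inter> e)"
        using edge_card[OF f] by simp
      also have "\<dots> \<le> (\<Sum>e\<in>B. card (f \<inter> e))"
        using B by (intro card_UN_le)
      also have "\<dots> \<le> (\<Sum>e\<in>B. 1)"
        using f B(1) \<open>f \<notin> M\<close> matchingsD(1)[OF M] by (intro sum_mono linear) auto
      finally have "k \<le> card B"
        by simp
      then have "x ^ card B \<le> x ^ k"
        using x by (intro power_decreasing)
      then show ?thesis by auto
    qed
  qed simp
  finally show ?thesis
    by (simp add: x_def)
qed

text \<open>Summed over all edges, the exceptional terms of \<open>card_avoiding_subsets\<close>
  amount to the degrees of the uncovered vertices and the \<open>m\<close> edges of
  \<open>M\<close>.\<close>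

lemma sum_avail_subsets_le:
  assumes M: "M \<in> matchings m" and m: "0 < m" "i \<le> m"
  shows "(\<Sum>I\<in>{I. I \<subseteq> M \<and> card I = i}. real (card (avail I)))
    \<le> real (m choose i) * (real (card H) * (1 - real i / real m) ^ k + real D * left m + real m)"
proof -
  let ?S = "{I. I \<subseteq> M \<and> card I = i}"
  have finS: "finite ?S"
    using matchingsD(4)[OF M] by (auto intro: finite_subset[of _ "Pow M"])
  have "(\<Sum>I\<in>?S. real (card (avail I))) = (\<Sum>I\<in>?S. \<Sum>f\<in>H. if f \<inter> \<Union>I = {} then 1 else 0)"
    by (intro sum.cong refl) (simp add: avail_def sum.If_cases finite_H Int_def)
  also have "\<dots> = (\<Sum>f\<in>H. \<Sum>I\<in>?S. if f \<inter> \<Union>I = {} then 1 else 0)"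
    by (rule sum.swap)
  also have "\<dots> = (\<Sum>f\<in>H. real (card {I. I \<subseteq> M \<and> card I = i \<and> f \<inter> \<Union>I = {}}))"
    using finS by (intro sum.cong refl) (simp add: sum.If_cases Int_def conj_ac)
  also have "\<dots> \<le> (\<Sum>f\<in>H. real (m choose i) *
      ((1 - real i / real m) ^ k + real (card (f \<inter> uncovered M)) + (if f \<in> M then 1 else 0)))"
    by (intro sum_mono card_avoiding_subsets M m)
  also have "\<dots> = real (m choose i) * (real (card H) * (1 - real i / real m) ^ k
      + real (\<Sum>f\<in>H. card (f \<inter> uncovered M)) + (\<Sum>f\<in>H. if f \<in> M then 1 else 0))"
    by (simp add: sum_distrib_left[symmetric] sum.distrib)
  also have "(\<Sum>f\<in>H. card (f \<inter> uncovered M)) = (\<Sum>v\<in>uncovered M. card {e \<in> H. v \<in> e})"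
    by (rule sum_degrees[symmetric]) (auto simp: finite_H finite_uncovered)
  also have "\<dots> = card (uncovered M) * D"
    by (simp add: uncovered_def degree)
  also have "(\<Sum>f\<in>H. if f \<in> M then 1 else 0) = real m"
    using matchingsD[OF M] by (simp add: sum.If_cases finite_H Int_absorb1 inf_commute)
  finally show ?thesis
    using card_uncovered_left[OF M] by (simp add: mult.commute)
qed

text \<open>Chain rule for the entropy of a uniformly random \<open>m\<close>-matching revealed edge by edge in random
  order: given the set \<open>I\<close> revealed so far, the next edge has at most \<open>card (avail I)\<close> choices.\<close>

lemma ln_card_matchings_le:
  assumes ne: "matchings m \<noteq> {}" and m: "0 < m"
  shows "ln (real (card (matchings m))) \<le>
    (\<Sum>i<m. ln (real (card H) * (1 - real i / real m) ^ k + real D * left m + real m)) - ln (fact m)"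
proof -
  define Z where "Z = real (card (matchings m))"
  define \<phi> where "\<phi> t = t * ln t" for t :: real
  \<comment> \<open>\<open>T i / Z\<close> is the mean of \<open>ln (ext m I)\<close>, the entropy
    that remains after \<open>i\<close> edges are revealed. It is \<open>ln Z\<close> at the start
    and 0 at the end.\<close>
  define T where "T i = (\<Sum>I\<in>matchings i. \<phi> (real (ext m I))) / real (m choose i)" for i
  define B where "B i = real (card H) * (1 - real i / real m) ^ k + real D * left m + real m" for i
  have Z: "0 < Z"
    using ne finite_matchings by (simp add: Z_def card_gt_0_iff)
  have left0: "0 \<le> left m"
  proof -
    obtain M where "M \<in> matchings m"
      using ne by blast
    then show ?thesis
      using card_uncovered_left[of M m] by (metis of_nat_0_le_iff)
  qed
  have step: "T i - T (Suc i) \<le> Z * (ln (B i) - ln (real (m - i)))" if i: "i < m" for i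
  proof -
    define C where "C = real (m choose i)"
    have C: "0 < C"
      using i by (simp add: C_def)
    have mi: "real (m - i) = real m - real i" "0 < real m - real i"
      using i by auto
    have Bpos: "0 < B i"
      using m i left0 by (auto simp: B_def intro!: add_nonneg_pos add_nonneg_nonneg mult_nonneg_nonneg)
    have "Suc i * (m choose Suc i) = (m - i) * (m choose i)"
      by (simp only: binomial_absorption binomial_absorb_comp)
    then have "real (Suc i * (m choose Suc i)) = real ((m - i) * (m choose i))"
      by (rule arg_cong)
    then have absorb: "(real i + 1) * real (m choose Suc i) = (real m - real i) * C"
      unfolding of_nat_mult mi C_def by (simp add: add.commute)
    have "T (Suc i) = ((real i + 1) * (\<Sum>J\<in>matchings (Suc i). \<phi> (real (ext m J)))) / ((real i + 1) * real (m choose Suc i))"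
      by (simp add: T_def)
    also have "\<dots> = (\<Sum>I\<in>matchings i. \<Sum>f\<in>avail I. \<phi> (real (ext m (insert f I)))) / ((real m - real i) * C)"
      unfolding absorb sum_matchings_Suc[symmetric] ..
    finally have T_Suc: "T (Suc i) = \<dots>" .
    \<comment> \<open>For fixed \<open>I\<close>, Jensen bounds the entropy of the next edge by
      \<open>ln (card (avail I))\<close>. The tangent of \<open>ln\<close> at \<open>B i\<close>
      makes this linear in \<open>card (avail I)\<close>, ready for averaging.\<close>
    have key: "(real m - real i) * \<phi> (real (ext m I)) - (\<Sum>f\<in>avail I. \<phi> (real (ext m (insert f I))))
        \<le> (real m - real i) * (real (ext m I) * (ln (B i) - ln (real m - real i) - 1) + real (ext m I) * real (card (avail I)) / B i)"
      if I: "I \<in> matchings i" for I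
    proof (cases "ext m I = 0")
      case True
      have "0 \<le> \<phi> (real n)" for n
        by (cases "n = 0") (auto simp: \<phi>_def)
      then have "0 \<le> (\<Sum>f\<in>avail I. \<phi> (real (ext m (insert f I))))"
        by (intro sum_nonneg)
      then show ?thesis
        using True by (simp add: \<phi>_def)
    next
      case False
      define a where "a = real (card (avail I))"
      define S where "S = (real m - real i) * real (ext m I)"
      have sumS: "(\<Sum>f\<in>avail I. real (ext m (insert f I))) = S"
        unfolding S_def using i by (intro sum_ext_insert I) auto
      have S: "0 < S"
        using False mi by (simp add: S_def)
      then have "avail I \<noteq> {}"
        using sumS by auto
      then have a: "0 < a"
        using finite_avail by (simp add: a_def card_gt_0_iff)
      have "S * ln (S / a) \<le> (\<Sum>f\<in>avail I. \<phi> (real (ext m (insert f I))))"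
        using sum_x_ln_x_ge[of "avail I" "\<lambda>f. real (ext m (insert f I))"] S
        by (simp add: sumS \<phi>_def finite_avail a_def)
      moreover have "S * ln (S / a) = S * (ln (real m - real i) + ln (real (ext m I)) - ln a)"
        using False mi a by (simp add: S_def ln_div ln_mult)
      moreover have "S * ln a \<le> S * (ln (B i) + a / B i - 1)"
      proof (intro mult_left_mono)
        have "ln (a / B i) \<le> a / B i - 1"
          using a Bpos by (intro ln_le_minus_one) auto
        then show "ln a \<le> ln (B i) + a / B i - 1"
          using a Bpos by (simp add: ln_div)
      qed (use S in simp)
      moreover have "(real m - real i) * \<phi> (real (ext m I)) = S * ln (real (ext m I))"
        by (simp add: \<phi>_def S_def)
      moreover have "(real m - real i) * (real (ext m I) * (ln (B i) - ln (real m - real i) - 1) + real (ext m I) * a / B i)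
          = S * (ln (B i) + a / B i - 1) - S * ln (real m - real i)"
        by (simp add: S_def algebra_simps add_divide_distrib diff_divide_distrib)
      ultimately show ?thesis
        unfolding a_def[symmetric] by (simp add: algebra_simps)
    qed
    have "T i - T (Suc i) = (\<Sum>I\<in>matchings i. (real m - real i) * \<phi> (real (ext m I))
        - (\<Sum>f\<in>avail I. \<phi> (real (ext m (insert f I))))) / ((real m - real i) * C)"
      unfolding T_Suc using mi C
      by (simp add: T_def C_def[symmetric] sum_subtractf diff_divide_distrib flip: sum_distrib_left)
    also have "\<dots> \<le> (\<Sum>I\<in>matchings i. (real m - real i) * (real (ext m I) * (ln (B i) - ln (real m - real i) - 1)
        + real (ext m I) * real (card (avail I)) / B i)) / ((real m - real i) * C)"
      using mi C by (intro divide_right_mono sum_mono key) auto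
    also have "\<dots> = (\<Sum>I\<in>matchings i. real (ext m I) * (ln (B i) - ln (real m - real i) - 1)
        + real (ext m I) * real (card (avail I)) / B i) / C"
      using mi by (simp flip: sum_distrib_left)
    also have "\<dots> = Z * (ln (B i) - ln (real m - real i) - 1)
        + (\<Sum>I\<in>matchings i. real (ext m I) * real (card (avail I))) / (B i * C)"
      using C by (simp add: sum.distrib sum_ext Z_def C_def[symmetric] add_divide_distrib
          flip: sum_distrib_right sum_divide_distrib)
    \<comment> \<open>On average at most \<open>B i\<close> edges are available, so the linear term
      contributes at most \<open>Z\<close> and cancels the \<open>- 1\<close> of the
      tangent.\<close>
    also have "(\<Sum>I\<in>matchings i. real (ext m I) * real (card (avail I))) \<le> Z * (C * B i)"
    proof -
      have "(\<Sum>I\<in>matchings i. real (ext m I) * real (card (avail I))) \<le> (\<Sum>M\<in>matchings m. C * B i)"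
        unfolding sum_ext_mult C_def B_def using i m by (intro sum_mono sum_avail_subsets_le) auto
      then show ?thesis by (simp add: Z_def)
    qed
    then have "(\<Sum>I\<in>matchings i. real (ext m I) * real (card (avail I))) / (B i * C) \<le> Z"
      using Bpos C by (simp add: field_simps)
    finally show ?thesis
      by (simp add: mi algebra_simps)
  qed
  have "T 0 - T m = (\<Sum>i<m. T i - T (Suc i))"
    by (simp add: sum_lessThan_telescope')
  also have "\<dots> \<le> (\<Sum>i<m. Z * (ln (B i) - ln (real (m - i))))"
    by (intro sum_mono step) auto
  also have "\<dots> = Z * ((\<Sum>i<m. ln (B i)) - (\<Sum>i<m. ln (real (m - i))))"
    by (simp add: sum_subtractf flip: sum_distrib_left)
  also have "(\<Sum>i<m. ln (real (m - i))) = ln (fact m)"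
  proof -
    have "(fact m :: real) = (\<Prod>i<m. real (m - i))"
      by (simp add: fact_prod_rev atLeast0LessThan)
    moreover have "ln (\<Prod>i<m. real (m - i)) = (\<Sum>i<m. ln (real (m - i)))"
      by (rule ln_prod) auto
    ultimately show ?thesis by (simp only:)
  qed
  also have "T 0 = Z * ln Z"
    by (simp add: T_def matchings_0 ext_def \<phi>_def Z_def)
  also have "T m = 0"
  proof -
    have "ext m I = 1" if "I \<in> matchings m" for I
    proof -
      have "{M \<in> matchings m. I \<subseteq> M} = {I}"
      proof -
        have "M = I" if "M \<in> matchings m" "I \<subseteq> M" for M
          using card_subset_eq[of M I] that matchingsD(3)[OF \<open>I \<in> matchings m\<close>] matchingsD(3,4)[OF that(1)]
          by simp
        then show ?thesis
          using that by auto
      qed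
      then show ?thesis by (simp add: ext_def)
    qed
    then show ?thesis by (simp add: T_def \<phi>_def)
  qed
  finally have "ln Z \<le> (\<Sum>i<m. ln (B i)) - ln (fact m)"
    using Z by simp
  then show ?thesis
    by (simp add: Z_def B_def)
qed

end

section \<open>Logarithms of factorials and of shifted products\<close>

lemma ln_fact_le:
  assumes "0 < m"
  shows "ln (fact m) \<le> (real m + 1) * ln (real m) - real m + 1"
  using assms
proof (induction m rule: nat_induct_non_zero)
  case (Suc m)
  \<comment> \<open>The induction step amounts to
    \<open>1 \<le> (m + 1) * ln ((m + 1) / m)\<close>.\<close>
  have "ln (real m / (real m + 1)) \<le> real m / (real m + 1) - 1"
    using Suc.hyps by (intro ln_le_minus_one) auto
  also have "\<dots> = - 1 / (real m + 1)"
    by (simp add: field_simps)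
  finally have "(real m + 1) * (ln (real m) - ln (real m + 1)) \<le> (real m + 1) * (- 1 / (real m + 1))"
    using Suc.hyps by (intro mult_left_mono) (auto simp: ln_div)
  then have "1 \<le> (real m + 1) * (ln (real m + 1) - ln (real m))"
    by (simp add: algebra_simps)
  moreover have "ln (fact (Suc m) :: real) = ln (real m + 1) + ln (fact m)"
    by (simp add: ln_mult add.commute)
  ultimately show ?case
    using Suc.IH by (simp add: algebra_simps)
qed simp

text \<open>\<open>((m + c) choose c) * b ^ c\<close> is one term of the expansion of
  \<open>(b + 1) ^ (m + c)\<close>.\<close>

lemma ln_binomial_le:
  fixes b :: real
  assumes "0 < b" "b \<le> 1" "real c \<le> b * real m"
  shows "ln (real ((m + c) choose c)) \<le> real m * (b * (2 + ln (1 / b)))"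
proof -
  have "real ((m + c) choose c) * b ^ c \<le> (\<Sum>j\<le>m + c. real ((m + c) choose j) * b ^ j * 1 ^ (m + c - j))"
    using member_le_sum[of c "{..m + c}" "\<lambda>j. real ((m + c) choose j) * b ^ j * 1 ^ (m + c - j)"] assms
    by simp
  also have "\<dots> = (b + 1) ^ (m + c)"
    by (rule binomial_ring[symmetric])
  finally have "ln (real ((m + c) choose c) * b ^ c) \<le> ln ((b + 1) ^ (m + c))"
    using assms by (subst ln_le_cancel_iff) auto
  then have "ln (real ((m + c) choose c)) \<le> real (m + c) * ln (b + 1) + real c * ln (1 / b)"
    using assms by (simp add: ln_mult ln_realpow ln_div)
  also have "\<dots> \<le> (2 * real m) * b + (b * real m) * ln (1 / b)"
  proof (intro add_mono mult_mono)
    have "b * real m \<le> 1 * real m"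
      using assms by (intro mult_right_mono) auto
    then show "real (m + c) \<le> 2 * real m"
      using assms by simp
    show "ln (b + 1) \<le> b"
      using assms ln_add_one_self_le_self[of b] by (simp add: add.commute)
  qed (use assms in auto)
  finally show ?thesis
    by (simp add: algebra_simps)
qed

lemma power_add_le:
  fixes x y :: real
  assumes "0 \<le> x" "0 \<le> y" "0 < k"
  shows "x ^ k + y ^ k \<le> (x + y) ^ k"
  using assms(3)
proof (induction k rule: nat_induct_non_zero)
  case (Suc k)
  have "x ^ Suc k + y ^ Suc k \<le> (x + y) * (x ^ k + y ^ k)"
    using assms by (simp add: algebra_simps)
  also have "\<dots> \<le> (x + y) * (x + y) ^ k"
    using Suc assms by (intro mult_left_mono) auto
  finally show ?case by simp
qed simp

text \<open>The shift \<open>a\<close> tempers the logarithms for \<open>i\<close> close to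
  \<open>m\<close>. Rounding \<open>a * m\<close> up to an integer \<open>c\<close> turns the
  product into \<open>((m + c) choose c) * fact m / m ^ m\<close>, so the shift costs only a
  binomial coefficient.\<close>

lemma sum_ln_shifted_le:
  fixes a b :: real
  assumes a: "0 < a" and b: "b = 2 * a" "b \<le> 1" and m: "1 \<le> a * real m"
  shows "(\<Sum>i<m. ln ((1 - real i / real m) + a)) \<le> real m * (b * (2 + ln (1 / b))) + ln (fact m) - real m * ln (real m)"
proof -
  have mpos: "0 < m"
    using m by (cases "m = 0") auto
  \<comment> \<open>\<open>b = 2 * a\<close> leaves room for the rounding because
    \<open>1 \<le> a * m\<close>.\<close>
  define c where "c = nat \<lceil>a * real m\<rceil>"
  have c: "a * real m \<le> real c" "real c \<le> b * real m"
    using m b by (auto simp: c_def) linarith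
  have "(\<Sum>i<m. ln ((1 - real i / real m) + a)) \<le> (\<Sum>i<m. ln (real (m + c - i)) - ln (real m))"
  proof (rule sum_mono)
    fix i assume "i \<in> {..<m}"
    then have i: "i < m" by simp
    have "(1 - real i / real m) + a = (real m - real i + a * real m) / real m"
      using mpos by (simp add: field_simps)
    also have "\<dots> \<le> real (m + c - i) / real m"
      using i c(1) by (intro divide_right_mono) (auto simp: of_nat_diff)
    finally have "ln ((1 - real i / real m) + a) \<le> ln (real (m + c - i) / real m)"
      using i a by (subst ln_le_cancel_iff) (auto intro!: add_nonneg_pos divide_pos_pos)
    then show "ln ((1 - real i / real m) + a) \<le> ln (real (m + c - i)) - ln (real m)"
      using i mpos by (simp add: ln_div)
  qed
  also have "\<dots> = (\<Sum>i<m. ln (real (m + c - i))) - real m * ln (real m)"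
    by (simp add: sum_subtractf)
  also have "(\<Sum>i<m. ln (real (m + c - i))) = ln (\<Prod>i<m. real (m + c - i))"
    by (rule ln_prod[symmetric]) auto
  also have "(\<Prod>i<m. real (m + c - i)) = real ((m + c) choose c) * fact m"
  proof -
    have "(\<Prod>i<m. real (m + c - i)) = (\<Prod>i<m. real (m + c) - real i)"
      by (intro prod.cong) (auto simp: of_nat_diff)
    also have "\<dots> = real ((m + c) choose m) * fact m"
      by (simp add: binomial_gbinomial gbinomial_prod_rev atLeast0LessThan)
    also have "(m + c) choose m = (m + c) choose c"
      using binomial_symmetric[of m "m + c"] by simp
    finally show ?thesis .
  qed
  also have "ln (real ((m + c) choose c) * fact m) = ln (real ((m + c) choose c)) + ln (fact m)"
    by (simp add: ln_mult)
  also have "\<dots> \<le> real m * (b * (2 + ln (1 / b))) + ln (fact m)"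
    using ln_binomial_le[of b c m] a b c(2) by simp
  finally show ?thesis
    by simp
qed

section \<open>Upper bound uniform in the size of the matching\<close>

context linear_hypergraph
begin

text \<open>Forgets disjointness and counts all sets of \<open>m\<close> edges; this serves for
  matchings far from perfect.\<close>

lemma ln_card_matchings_le_crude:
  assumes ne: "matchings m \<noteq> {}" and m: "0 < m"
  shows "ln (real (card (matchings m))) \<le> real m * ln (real (card H)) - ln (fact m)"
proof -
  have "card (matchings m) \<le> card {M. M \<subseteq> H \<and> card M = m}"
    using finite_H by (intro card_mono finite_subset[of "{M. M \<subseteq> H \<and> card M = m}" "Pow H"]) (auto simp: matchings_def)
  also have "\<dots> = card H choose m"
    using finite_H by (rule n_subsets)
  finally have "card (matchings m) * fact m \<le> (card H choose m) * fact m"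
    by (rule mult_right_mono) simp
  also have "\<dots> \<le> card H ^ m"
    by (rule binomial_fact_pow)
  finally have "real (card (matchings m) * fact m) \<le> real (card H ^ m)"
    by (rule of_nat_mono)
  then have le: "real (card (matchings m)) * fact m \<le> real (card H) ^ m"
    by simp
  have Z: "0 < real (card (matchings m))"
    using ne finite_matchings by (simp add: card_gt_0_iff)
  obtain M where "M \<in> matchings m"
    using ne by blast
  then have "card H \<noteq> 0"
    using matchingsD[of M m] m finite_H by auto
  then have H: "0 < real (card H)"
    by simp
  have "ln (real (card (matchings m)) * fact m) \<le> ln (real (card H) ^ m)"
    using le Z H by (subst ln_le_cancel_iff) auto
  then show ?thesis
    using Z H by (simp add: ln_mult ln_realpow)
qed

text \<open>\<open>P\<close> is the size of a perfect matching and \<open>\<delta>\<close> the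
  fraction missing from it. If \<open>\<delta>\<close> is not tiny, the deficit
  \<open>\<delta> * P * ln D\<close> in the crude bound outweighs \<open>k * P\<close>; otherwise
  the entropy bound applies and its error terms fit under the shift \<open>a\<close>.\<close>

lemma ln_card_matchings_le_uniform:
  fixes a b P :: real
  assumes P: "P = real (card V) / real k" and a: "0 < a" and b: "b = 2 * a" "b \<le> 1"
    and large: "2 * real k ^ 2 \<le> a ^ k * ln (real D)" "2 \<le> a ^ k * real D" "2 \<le> a * P"
    and ne: "matchings m \<noteq> {}"
  shows "ln (real (card (matchings m))) \<le> P * (ln (real D) + 1 - real k)
    + (real k - 1) * (ln P + 1) + real k * P * (b * (2 + ln (1 / b)))"
proof -
  define h where "h = b * (2 + ln (1 / b))"
  have k2: "2 \<le> real k" and Dpos: "0 < real D"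
    using k_ge_2 D_pos by auto
  have a1: "a \<le> 1 / 2" and h0: "0 \<le> h"
    using a b by (auto simp: h_def)
  have ak: "0 < a ^ k" "a ^ k \<le> 1"
    using a a1 by (auto intro: power_le_one)
  have P4: "4 \<le> P"
  proof -
    have "a * P \<le> (1 / 2) * P"
      using a1 card_V_pos by (intro mult_right_mono) (auto simp: P)
    then show ?thesis
      using large(3) by linarith
  qed
  have "0 \<le> ln (real D)"
    using D_pos by simp
  then have "a ^ k * ln (real D) \<le> 1 * ln (real D)"
    using ak by (intro mult_right_mono) auto
  then have "2 * real k ^ 2 \<le> ln (real D)"
    using large(1) by linarith
  moreover have "2 * real k \<le> 2 * real k ^ 2"
    using k2 by (simp add: power2_eq_square)
  ultimately have lnD: "2 * real k \<le> ln (real D)"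
    by linarith
  have extra: "0 \<le> (real k - 1) * (ln P + 1) + real k * P * h"
    using k2 P4 h0 by (intro add_nonneg_nonneg mult_nonneg_nonneg) auto
  have EPD: "real (card H) = P * real D"
    using arg_cong[OF card_H, of real] k2 by (simp add: P field_simps)
  show ?thesis
  proof (cases "m = 0")
    case True
    have "0 \<le> P * (ln (real D) + 1 - real k)"
      using P4 lnD k2 by (intro mult_nonneg_nonneg) auto
    then show ?thesis
      using True extra by (simp add: matchings_0 h_def)
  next
    case False
    then have m: "0 < m" by simp
    have left: "left m = real k * (P - real m)"
      using k2 by (simp add: left_def P algebra_simps)
    obtain M where "M \<in> matchings m"
      using ne by blast
    then have "0 \<le> left m"
      using card_uncovered_left[of M m] by (metis of_nat_0_le_iff)
    then have mP: "real m \<le> P"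
      using k2 by (simp add: left zero_le_mult_iff)
    define \<delta> where "\<delta> = 1 - real m / P"
    have \<delta>: "0 \<le> \<delta>" and m_eq: "real m = P - \<delta> * P" "P - real m = \<delta> * P"
      using mP P4 by (auto simp: \<delta>_def field_simps)
    have ratio: "real m * ln P - real m * ln (real m) \<le> \<delta> * P"
    proof -
      have "ln (P / real m) \<le> P / real m - 1"
        using P4 m by (intro ln_le_minus_one) auto
      then have "real m * ln (P / real m) \<le> real m * (P / real m - 1)"
        by (intro mult_left_mono) auto
      moreover have "real m * ln (P / real m) = real m * ln P - real m * ln (real m)"
        using m P4 by (simp add: ln_div algebra_simps)
      moreover have "real m * (P / real m - 1) = P - real m"
        using m by (simp add: algebra_simps)
      ultimately show ?thesis
        using m_eq(2) by linarith
    qed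
    show ?thesis
    \<comment> \<open>Above the threshold \<open>large(1)\<close> gives
      \<open>k \<le> \<delta> * ln D\<close>; below it \<open>D * left m\<close> is at most half of
      \<open>P * D * a ^ k\<close>.\<close>
    proof (cases "a ^ k \<le> 2 * real k * \<delta>")
      case True
      have "2 * real k ^ 2 \<le> 2 * real k * \<delta> * ln (real D)"
        using large(1) mult_right_mono[OF True, of "ln (real D)"] lnD k2 by linarith
      then have "(2 * real k) * real k \<le> (2 * real k) * (\<delta> * ln (real D))"
        by (simp add: power2_eq_square algebra_simps)
      then have "real k \<le> \<delta> * ln (real D)"
        using k2 by simp
      then have "P * real k \<le> P * (\<delta> * ln (real D))"
        using P4 by (intro mult_left_mono) auto
      moreover have "ln (real (card (matchings m))) \<le> real m * (ln P + ln (real D)) - (real m * ln (real m) - real m)"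
        using ln_card_matchings_le_crude[OF ne m] ln_fact_ge[of m] P4 Dpos
        by (simp add: EPD ln_mult)
      moreover have "real m * ln (real D) = P * ln (real D) - P * (\<delta> * ln (real D))"
        unfolding m_eq(1) by (simp add: algebra_simps)
      ultimately have "ln (real (card (matchings m))) \<le> P * (ln (real D) + 1 - real k)"
        using ratio m_eq by (simp add: algebra_simps)
      then show ?thesis
        using extra by (simp add: h_def)
    next
      case False
      have "2 * real k * \<delta> < 1"
        using False ak by linarith
      moreover have "4 * \<delta> \<le> 2 * real k * \<delta>"
        using k2 \<delta> by (intro mult_right_mono) auto
      ultimately have "\<delta> \<le> 1 / 2"
        by linarith
      then have "\<delta> * P \<le> (1 / 2) * P"
        using P4 by (intro mult_right_mono) auto
      then have "P / 2 \<le> real m"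
        using m_eq by linarith
      then have "a * (P / 2) \<le> a * real m"
        using a by (intro mult_left_mono) auto
      then have am: "1 \<le> a * real m"
        using large(3) by linarith
      \<comment> \<open>Half of \<open>P * D * a ^ k\<close> absorbs the uncovered vertices and half
        the \<open>m\<close> edges of the matching; \<open>power_add_le\<close> then merges
        \<open>x ^ k + a ^ k\<close>.\<close>
      have B: "ln (real (card H) * (1 - real i / real m) ^ k + real D * left m + real m)
          \<le> ln P + ln (real D) + real k * ln ((1 - real i / real m) + a)" if i: "i < m" for i
      proof -
        define x where "x = 1 - real i / real m"
        have x: "0 \<le> x"
          using i by (simp add: x_def)
        have "real D * left m = P * real D * (real k * \<delta>)"
          unfolding left m_eq(2) by simp
        also have "\<dots> \<le> P * real D * (a ^ k / 2)"
          using False P4 by (intro mult_left_mono) auto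
        finally have l: "real D * left m \<le> P * real D * (a ^ k / 2)" .
        have "real m \<le> P * 1"
          using mP by simp
        also have "\<dots> \<le> P * (real D * (a ^ k / 2))"
          using large(2) P4 by (intro mult_left_mono) (auto simp: algebra_simps)
        finally have r: "real m \<le> P * real D * (a ^ k / 2)"
          by simp
        have "real (card H) * x ^ k + real D * left m + real m \<le> P * real D * (x ^ k + a ^ k)"
          using l r by (simp add: EPD algebra_simps)
        also have "\<dots> \<le> P * real D * (x + a) ^ k"
          using P4 x a k_ge_2 by (intro mult_left_mono power_add_le) auto
        finally have "ln (real (card H) * x ^ k + real D * left m + real m) \<le> ln (P * real D * (x + a) ^ k)"
          using x a P4 Dpos m \<open>0 \<le> left m\<close>
          by (subst ln_le_cancel_iff) (auto intro!: add_nonneg_pos add_nonneg_nonneg mult_nonneg_nonneg mult_pos_pos)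
        also have "\<dots> = ln P + ln (real D) + real k * ln (x + a)"
          using x a P4 Dpos by (simp add: ln_mult ln_realpow)
        finally show ?thesis
          by (simp add: x_def)
      qed
      have "ln (real (card (matchings m))) \<le>
          (\<Sum>i<m. ln P + ln (real D) + real k * ln ((1 - real i / real m) + a)) - ln (fact m)"
      proof -
        have "(\<Sum>i<m. ln (real (card H) * (1 - real i / real m) ^ k + real D * left m + real m))
            \<le> (\<Sum>i<m. ln P + ln (real D) + real k * ln ((1 - real i / real m) + a))"
          by (intro sum_mono B) auto
        then show ?thesis
          using ln_card_matchings_le[OF ne m] by linarith
      qed
      also have "\<dots> = real m * (ln P + ln (real D)) + real k * (\<Sum>i<m. ln ((1 - real i / real m) + a)) - ln (fact m)"
        by (simp only: sum.distrib sum_constant card_lessThan sum_distrib_left) (simp add: algebra_simps)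
      also have "\<dots> \<le> real m * (ln P + ln (real D))
          + real k * (real m * h + ln (fact m) - real m * ln (real m)) - ln (fact m)"
        using sum_ln_shifted_le[OF a b am] by (intro diff_right_mono add_left_mono mult_left_mono) (auto simp: h_def)
      also have "\<dots> = real m * (ln P + ln (real D)) + real k * (real m * h) - real k * (real m * ln (real m))
          + (real k - 1) * ln (fact m)"
        by (simp add: algebra_simps)
      also have "\<dots> \<le> real m * (ln P + ln (real D)) + real k * (real m * h) - real k * (real m * ln (real m))
          + (real k - 1) * ((real m + 1) * ln (real m) - real m + 1)"
        using ln_fact_le[OF m] k2 by (intro add_left_mono mult_left_mono) auto
      also have "\<dots> = (real m * ln P - real m * ln (real m)) + real m * (ln (real D) + 1 - real k)
          + (real k - 1) * (ln (real m) + 1) + real k * (real m * h)"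
        by (simp add: algebra_simps)
      also have "\<dots> \<le> \<delta> * P + real m * (ln (real D) + 1 - real k) + (real k - 1) * (ln P + 1) + real k * (P * h)"
        using ratio k2 mP m h0 by (intro add_mono mult_left_mono mult_right_mono order_refl) auto
      \<comment> \<open>The missing edges pay for the extra \<open>\<delta> * P\<close>: each would
        have contributed \<open>ln D + 1 - k\<close>, which is at least 1.\<close>
      also have "\<delta> * P + real m * (ln (real D) + 1 - real k) \<le> P * (ln (real D) + 1 - real k)"
      proof -
        have "0 \<le> \<delta> * P * (ln (real D) - real k)"
          using \<delta> P4 lnD k2 by (intro mult_nonneg_nonneg) auto
        then show ?thesis
          unfolding m_eq(1) by (simp add: algebra_simps)
      qed
      finally show ?thesis
        by (simp add: h_def)
    qed
  qed
qed

definition all_matchings :: "'v set set set" where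
  "all_matchings = {M. M \<subseteq> H \<and> pairwise disjnt M}"

lemma all_matchings_eq: "all_matchings = (\<Union>m\<le>card V. matchings m)"
proof -
  have "m \<le> card V" if "M \<in> matchings m" for m M
  proof -
    have "m * 1 \<le> m * k"
      using k_ge_2 by (intro mult_left_mono) auto
    then show ?thesis
      using card_uncovered[OF that] by linarith
  qed
  then show ?thesis
    unfolding all_matchings_def by (auto simp: matchings_def)
qed

lemma card_matchings_le_all: "card (matchings m) \<le> card all_matchings"
  by (rule card_mono) (auto simp: all_matchings_def finite_H matchings_def intro: finite_subset[of _ "Pow H"])

text \<open>All \<open>card V + 1\<close> candidate sizes obey the same bound, so the union costs
  only \<open>ln (card V + 1)\<close>.\<close>

lemma ln_card_all_matchings_le:
  fixes a b P :: real
  assumes P: "P = real (card V) / real k" and a: "0 < a" and b: "b = 2 * a" "b \<le> 1"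
    and large: "2 * real k ^ 2 \<le> a ^ k * ln (real D)" "2 \<le> a ^ k * real D" "2 \<le> a * P"
  shows "ln (real (card all_matchings)) \<le> ln (real (card V) + 1) + P * (ln (real D) + 1 - real k)
    + (real k - 1) * (ln P + 1) + real k * P * (b * (2 + ln (1 / b)))"
proof -
  define R where "R = P * (ln (real D) + 1 - real k)
    + (real k - 1) * (ln P + 1) + real k * P * (b * (2 + ln (1 / b)))"
  have "real (card (matchings m)) \<le> exp R" for m
  proof (cases "matchings m = {}")
    case False
    then have "0 < real (card (matchings m))"
      using finite_matchings by (simp add: card_gt_0_iff)
    moreover have "ln (real (card (matchings m))) \<le> R"
      unfolding R_def by (rule ln_card_matchings_le_uniform[OF P a b large False])
    ultimately show ?thesis
      by (metis exp_le_cancel_iff exp_ln)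
  qed simp
  then have "(\<Sum>m\<le>card V. real (card (matchings m))) \<le> (\<Sum>m\<le>card V. exp R)"
    by (intro sum_mono)
  moreover have "real (card all_matchings) \<le> real (\<Sum>m\<le>card V. card (matchings m))"
    unfolding all_matchings_eq of_nat_le_iff by (rule card_UN_le) simp
  ultimately have "real (card all_matchings) \<le> (real (card V) + 1) * exp R"
    by (simp add: add.commute)
  moreover have "0 < card all_matchings"
    using card_matchings_le_all[of 0] by (simp add: matchings_0)
  ultimately have "ln (real (card all_matchings)) \<le> ln ((real (card V) + 1) * exp R)"
    by (subst ln_le_cancel_iff) (auto simp: add_pos_nonneg)
  then show ?thesis
    by (simp add: ln_mult R_def add_nonneg_pos add.assoc)
qed

end

section \<open>Sparse paving matroids as matchings\<close>

text \<open>For \<open>r \<ge> 1\<close> these are the stable sets of the Johnson graph, where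
  \<open>r\<close>-sets sharing \<open>r - 1\<close> points are adjacent.\<close>

definition sp_family :: "'a set \<Rightarrow> nat \<Rightarrow> 'a set set set" where
  "sp_family E r = {C. C \<subseteq> {S. S \<subseteq> E \<and> card S = r} \<and>
     (\<forall>S\<in>C. \<forall>T\<in>C. S \<noteq> T \<longrightarrow> card (S \<inter> T) < r - 1)}"

lemma rank_of_ge:
  assumes "finite X" "Y \<in> \<I>" "Y \<subseteq> X"
  shows "card Y \<le> rank_of \<I> X"
  unfolding rank_of_def
  by (rule Max_ge) (use assms in \<open>auto intro: finite_subset[of _ "Pow X"]\<close>)

lemma rank_of_attained:
  assumes "finite X" "{} \<in> \<I>"
  obtains Y where "Y \<in> \<I>" "Y \<subseteq> X" "card Y = rank_of \<I> X"
proof -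
  have "rank_of \<I> X \<in> card ` {Y \<in> \<I>. Y \<subseteq> X}"
    unfolding rank_of_def
    by (rule Max_in) (use assms in \<open>auto intro: finite_subset[of _ "Pow X"]\<close>)
  then show ?thesis
    using that by auto
qed

text \<open>Exchanging one point of an \<open>r\<close>-set gives another with \<open>r - 1\<close>
  common points, and \<open>C\<close> cannot contain both.\<close>

lemma exists_outside_family:
  assumes "finite X" "r < card X" "1 \<le> r"
    and sep: "\<forall>S\<in>C. \<forall>T\<in>C. S \<noteq> T \<longrightarrow> card (S \<inter> T) < r - 1"
  obtains S where "S \<subseteq> X" "card S = r" "S \<notin> C"
proof -
  obtain S where S: "S \<subseteq> X" "card S = r" "finite S"
    using assms obtain_subset_with_card_n[of r X] by (metis less_imp_le)
  obtain x where x: "x \<in> X" "x \<notin> S"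
    using S assms(2) by (metis nat_less_le subsetI subset_antisym)
  obtain s where s: "s \<in> S"
    using S assms(3) by fastforce
  define T where "T = insert x (S - {s})"
  have T: "T \<subseteq> X" "card T = r" "S \<inter> T = S - {s}" "S \<noteq> T"
    using S x s assms(3) by (auto simp: T_def)
  have "\<not> card (S \<inter> T) < r - 1"
    using T(3) S s by simp
  then have "S \<notin> C \<or> T \<notin> C"
    using sep T(4) by blast
  then show ?thesis
    using S T that by blast
qed

text \<open>The set is the closure of \<open>F\<close>: by augmentation it has no independent subset
  larger than \<open>F\<close>, while every point outside extends \<open>F\<close>.\<close>

lemma (in matroid) hyperplane_of_independent:
  assumes F: "F \<in> \<I>" "card F + 1 = rank_of \<I> E"
  shows "hyperplane E \<I> (F \<union> {x \<in> E. insert x F \<notin> \<I>})"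
proof -
  let ?H = "F \<union> {x \<in> E. insert x F \<notin> \<I>}"
  have FE: "F \<subseteq> E" and HE: "?H \<subseteq> E"
    using indep_subset_ground[OF F(1)] by auto
  have finH: "finite ?H"
    using HE finite_ground finite_subset by blast
  have small: "card Y \<le> card F" if Y: "Y \<in> \<I>" "Y \<subseteq> ?H" for Y
  proof (rule ccontr)
    assume "\<not> card Y \<le> card F"
    then obtain y where "y \<in> Y - F" "insert y F \<in> \<I>"
      using indep_augment[OF F(1) Y(1)] by auto
    then show False
      using Y(2) by auto
  qed
  obtain Y where "Y \<in> \<I>" "Y \<subseteq> ?H" "card Y = rank_of \<I> ?H"
    using rank_of_attained[OF finH indep_empty] by blast
  moreover have "card F \<le> rank_of \<I> ?H"
    using finH F by (intro rank_of_ge) auto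
  ultimately have rankH: "rank_of \<I> ?H = card F"
    using small by fastforce
  have "rank_of \<I> ?H < rank_of \<I> (insert x ?H)" if x: "x \<in> E - ?H" for x
  proof -
    have "insert x F \<in> \<I>" "x \<notin> F"
      using x by auto
    moreover have "finite F"
      using FE finite_ground finite_subset by blast
    ultimately have "Suc (card F) \<le> rank_of \<I> (insert x ?H)"
      using rank_of_ge[of "insert x ?H" "insert x F" \<I>] finH by auto
    then show ?thesis
      using rankH by simp
  qed
  then show ?thesis
    unfolding hyperplane_def flat_def using HE rankH F(2) by auto
qed

text \<open>Two dependent \<open>r\<close>-sets with \<open>r - 1\<close> common points would both
  lie in the closure of their intersection, a hyperplane that would then have at least
  \<open>r + 1\<close> points.\<close>

lemma nonbases_of_sparse_paving:
  assumes sp: "sparse_paving E \<I>" and r: "rank_of \<I> E = r" "1 \<le> r"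
  shows "{S. S \<subseteq> E \<and> card S = r \<and> S \<notin> \<I>} \<in> sp_family E r"
    and "{X. X \<subseteq> E \<and> card X \<le> r \<and> X \<notin> {S. S \<subseteq> E \<and> card S = r \<and> S \<notin> \<I>}} = \<I>"
proof -
  have mat: "matroid E \<I>" and pav: "\<And>F. F \<subseteq> E \<Longrightarrow> card F < r \<Longrightarrow> F \<in> \<I>"
    and hyp: "\<And>H. hyperplane E \<I> H \<Longrightarrow> card H = r - 1 \<or> card H = r"
    using sp r by (auto simp: sparse_paving_def paving_def)
  interpret matroid E \<I>
    by (rule mat)
  have "card (S \<inter> T) < r - 1"
    if S: "S \<subseteq> E" "card S = r" "S \<notin> \<I>" and T: "T \<subseteq> E" "card T = r" "T \<notin> \<I>" and "S \<noteq> T" for S T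
  proof (rule ccontr)
    assume no: "\<not> card (S \<inter> T) < r - 1"
    have fin: "finite S" "finite T"
      using S T finite_ground finite_subset by auto
    have "S \<inter> T \<subset> S"
      using \<open>S \<noteq> T\<close> S T fin card_subset_eq[of T S] by auto
    then have cF: "card (S \<inter> T) + 1 = r"
      using psubset_card_mono[OF fin(1), of "S \<inter> T"] no S by simp
    let ?F = "S \<inter> T"
    let ?H = "?F \<union> {x \<in> E. insert x ?F \<notin> \<I>}"
    have "?F \<in> \<I>"
      using S cF by (intro pav) auto
    then have "hyperplane E \<I> ?H"
      using cF r by (intro hyperplane_of_independent) auto
    then have "card ?H \<le> r"
      using hyp by fastforce
    moreover have sub: "U \<subseteq> ?H" if U: "U \<subseteq> E" "card U = r" "U \<notin> \<I>" "?F \<subseteq> U" "finite U" for U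
    proof
      fix x assume x: "x \<in> U"
      show "x \<in> ?H"
      proof (cases "x \<in> ?F")
        case False
        have "card (insert x ?F) = card U"
          using False fin cF U by simp
        then have "insert x ?F = U"
          using U x by (intro card_subset_eq) auto
        then show ?thesis
          using U x by auto
      qed simp
    qed
    have "S \<union> T \<subseteq> ?H"
      using sub[of S] sub[of T] S T fin by blast
    moreover have "finite ?H"
      using finite_ground S by (auto intro: finite_subset)
    moreover have "card (S \<union> T) = r + 1"
      using card_Un_Int[OF fin] S T cF by linarith
    ultimately show False
      using card_mono[of ?H "S \<union> T"] by linarith
  qed
  then show "{S. S \<subseteq> E \<and> card S = r \<and> S \<notin> \<I>} \<in> sp_family E r"
    by (auto simp: sp_family_def)
  have "card X \<le> r" if "X \<in> \<I>" for X
    using rank_of_ge[OF finite_ground that indep_subset_ground[OF that]] r by simp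
  then show "{X. X \<subseteq> E \<and> card X \<le> r \<and> X \<notin> {S. S \<subseteq> E \<and> card S = r \<and> S \<notin> \<I>}} = \<I>"
    using pav indep_subset_ground by (auto simp: le_less)
qed

text \<open>Augmentation is in doubt only for \<open>card X = r - 1\<close>, where two one-point
  extensions of \<open>X\<close> cannot both be in \<open>C\<close>. Every set of more than
  \<open>r\<close> points contains a basis, which bounds the hyperplanes. For
  \<open>r = card E\<close> the family \<open>{E}\<close> would lower the rank.\<close>

lemma sparse_paving_of_family:
  assumes C: "C \<in> sp_family E r" and E: "finite E" "r < card E" and r: "1 \<le> r"
  defines "\<I> \<equiv> {X. X \<subseteq> E \<and> card X \<le> r \<and> X \<notin> C}"
  shows "sparse_paving E \<I>" "rank_of \<I> E = r" "{S. S \<subseteq> E \<and> card S = r \<and> S \<notin> \<I>} = C"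
proof -
  have Cr: "\<And>S. S \<in> C \<Longrightarrow> S \<subseteq> E \<and> card S = r"
    and sep: "\<forall>S\<in>C. \<forall>T\<in>C. S \<noteq> T \<longrightarrow> card (S \<inter> T) < r - 1"
    using C by (auto simp: sp_family_def)
  have small: "X \<in> \<I>" if "X \<subseteq> E" "card X < r" for X
    using that Cr[of X] by (auto simp: \<I>_def)
  have mat: "matroid E \<I>"
  proof
    show "{} \<in> \<I>"
      using r by (intro small) auto
    show "Y \<in> \<I>" if "X \<in> \<I>" "Y \<subseteq> X" for X Y
    proof (cases "Y = X")
      case False
      have "finite X"
        using that E(1) by (auto simp: \<I>_def intro: finite_subset)
      then have "card Y < card X"
        using that False by (intro psubset_card_mono) auto
      then show ?thesis
        using that by (intro small) (auto simp: \<I>_def)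
    qed (use that in simp)
    show "\<exists>y\<in>Y - X. insert y X \<in> \<I>" if X: "X \<in> \<I>" and Y: "Y \<in> \<I>" and lt: "card X < card Y" for X Y
    proof -
      have XY: "X \<subseteq> E" "Y \<subseteq> E" "card Y \<le> r" "Y \<notin> C"
        using X Y by (auto simp: \<I>_def)
      have fin: "finite X" "finite Y"
        using XY E(1) finite_subset by auto
      have "\<not> Y \<subseteq> X"
        using lt fin card_mono by (metis not_le)
      then obtain y where y: "y \<in> Y" "y \<notin> X"
        by auto
      show ?thesis
      proof (cases "insert y X \<in> \<I>")
        case False
        have cy: "card (insert y X) = Suc (card X)"
          using y fin by simp
        then have yC: "insert y X \<in> C"
          using False y XY lt by (auto simp: \<I>_def)
        then have cX: "Suc (card X) = r"
          using Cr cy by simp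
        \<comment> \<open>Otherwise \<open>Y\<close> would equal \<open>insert y X\<close>, a member
          of \<open>C\<close>; hence \<open>Y\<close> offers a second point
          \<open>z\<close>.\<close>
        have "\<not> Y \<subseteq> insert y X"
        proof
          assume "Y \<subseteq> insert y X"
          then have "Y = insert y X"
            using lt cy fin by (intro card_subset_eq card_seteq) auto
          then show False
            using yC XY by simp
        qed
        then obtain z where z: "z \<in> Y" "z \<notin> X" "z \<noteq> y"
          by auto
        have "insert z X \<notin> C"
        proof
          assume "insert z X \<in> C"
          moreover have "insert z X \<noteq> insert y X" "insert z X \<inter> insert y X = X"
            using z y by auto
          ultimately show False
            using sep yC cX by fastforce
        qed
        moreover have "card (insert z X) \<le> r"
          using z fin cX by simp
        ultimately have "insert z X \<in> \<I>"
          using z XY by (auto simp: \<I>_def)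
        then show ?thesis
          using z by auto
      qed (use y in auto)
    qed
  qed (use E in \<open>auto simp: \<I>_def\<close>)
  interpret matroid E \<I>
    by (rule mat)
  have basis: "r \<le> rank_of \<I> X" if X: "X \<subseteq> E" "r < card X" for X
  proof -
    have finX: "finite X"
      using X E finite_subset by auto
    obtain S where S: "S \<subseteq> X" "card S = r" "S \<notin> C"
      using exists_outside_family[OF finX X(2) r sep] by blast
    then have "S \<in> \<I>"
      using X by (auto simp: \<I>_def)
    then show ?thesis
      using rank_of_ge[OF finX, of S \<I>] S by simp
  qed
  obtain Y where "Y \<in> \<I>" "card Y = rank_of \<I> E"
    using rank_of_attained[OF E(1) indep_empty] by blast
  then have "rank_of \<I> E \<le> r"
    by (auto simp: \<I>_def)
  then show rank: "rank_of \<I> E = r"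
    using basis[of E] E by simp
  have "card H = r - 1 \<or> card H = r" if H: "hyperplane E \<I> H" for H
  proof -
    have HE: "H \<subseteq> E" and rH: "rank_of \<I> H + 1 = r"
      using H rank by (auto simp: hyperplane_def flat_def)
    have finH: "finite H"
      using HE E finite_subset by auto
    obtain Y where "Y \<in> \<I>" "Y \<subseteq> H" "card Y = rank_of \<I> H"
      using rank_of_attained[OF finH indep_empty] by blast
    then have "r - 1 \<le> card H"
      using card_mono[OF finH] rH by (metis add_diff_cancel_right')
    moreover have "card H \<le> r"
      using basis[OF HE] rH by linarith
    ultimately show ?thesis
      by linarith
  qed
  then show "sparse_paving E \<I>"
    using mat small rank by (auto simp: sparse_paving_def paving_def)
  show "{S. S \<subseteq> E \<and> card S = r \<and> S \<notin> \<I>} = C"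
    using Cr by (auto simp: \<I>_def)
qed

lemma num_sparse_paving_eq:
  assumes "1 \<le> r" "r < n"
  shows "num_sparse_paving n r = card (sp_family {1..n} r)"
proof -
  have "bij_betw (\<lambda>\<I>. {S. S \<subseteq> {1..n} \<and> card S = r \<and> S \<notin> \<I>})
     {\<I>. sparse_paving {1..n} \<I> \<and> rank_of \<I> {1..n} = r} (sp_family {1..n} r)"
    by (rule bij_betw_byWitness[where f' = "\<lambda>C. {X. X \<subseteq> {1..n} \<and> card X \<le> r \<and> X \<notin> C}"])
       (use assms nonbases_of_sparse_paving[of "{1..n}" _ r] sparse_paving_of_family[of _ "{1..n}" r] in auto)
  then show ?thesis
    unfolding num_sparse_paving_def by (rule bij_betw_same_card)
qed

section \<open>The hypergraph of facets\<close>

definition facets :: "nat \<Rightarrow> 'a set \<Rightarrow> 'a set set" where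
  "facets r S = {T. T \<subseteq> S \<and> card T = r - 1}"

lemma facets_disjoint_iff:
  assumes "finite S" "finite T"
  shows "facets r S \<inter> facets r T = {} \<longleftrightarrow> card (S \<inter> T) < r - 1"
proof -
  have "facets r S \<inter> facets r T = {U. U \<subseteq> S \<inter> T \<and> card U = r - 1}"
    by (auto simp: facets_def)
  moreover have "{U. U \<subseteq> S \<inter> T \<and> card U = r - 1} = {} \<longleftrightarrow> card (S \<inter> T) < r - 1"
  proof
    assume "card (S \<inter> T) < r - 1"
    then have "card U \<noteq> r - 1" if "U \<subseteq> S \<inter> T" for U
      using card_mono[OF _ that] assms by fastforce
    then show "{U. U \<subseteq> S \<inter> T \<and> card U = r - 1} = {}"
      by blast
  next
    assume "{U. U \<subseteq> S \<inter> T \<and> card U = r - 1} = {}"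
    then show "card (S \<inter> T) < r - 1"
      by (metis (mono_tags, lifting) emptyE mem_Collect_eq not_less obtain_subset_with_card_n)
  qed
  ultimately show ?thesis by simp
qed

lemma Union_facets:
  assumes "card S = r" "2 \<le> r"
  shows "\<Union>(facets r S) = S"
proof -
  have fin: "finite S"
    using assms card.infinite by fastforce
  have "x \<in> \<Union>(facets r S)" if x: "x \<in> S" for x
  proof -
    have "S \<noteq> {x}"
      using assms by auto
    then obtain y where y: "y \<in> S" "y \<noteq> x"
      using x by auto
    then have "S - {y} \<in> facets r S" "x \<in> S - {y}"
      using assms fin x by (auto simp: facets_def)
    then show ?thesis by blast
  qed
  then show ?thesis
    by (auto simp: facets_def)
qed

lemma inj_on_facets: "2 \<le> r \<Longrightarrow> inj_on (facets r) {S. S \<subseteq> E \<and> card S = r}"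
  by (rule inj_on_inverseI[where g = Union]) (auto simp: Union_facets)

text \<open>An \<open>(r - 1)\<close>-set \<open>T\<close> lies in \<open>insert x T\<close> for
  each of the \<open>card E - r + 1\<close> points outside it, which gives the degree. The only
  facet that distinct \<open>r\<close>-sets can share is their intersection, which gives
  linearity.\<close>

lemma linear_hypergraph_facets:
  assumes E: "finite E" and r: "2 \<le> r" and n: "r \<le> card E"
  shows "linear_hypergraph {T. T \<subseteq> E \<and> card T = r - 1}
    (facets r ` {S. S \<subseteq> E \<and> card S = r}) r (card E - r + 1)"
proof
  let ?V = "{T. T \<subseteq> E \<and> card T = r - 1}" and ?S = "{S. S \<subseteq> E \<and> card S = r}"
  have fin: "finite S" if "S \<subseteq> E" for S
    using that E finite_subset by blast
  show "finite ?V"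
    by (rule finite_subset[of _ "Pow E"]) (auto simp: E)
  show "e \<subseteq> ?V" if "e \<in> facets r ` ?S" for e
    using that by (auto simp: facets_def)
  show "card e = r" if e: "e \<in> facets r ` ?S" for e
  proof -
    obtain S where S: "S \<in> ?S" "e = facets r S"
      using e by auto
    then have "card e = r choose (r - 1)"
      using fin[of S] by (simp add: facets_def n_subsets)
    also have "\<dots> = r"
      using r binomial_symmetric[of "r - 1" r] by simp
    finally show ?thesis .
  qed
  show "card {e \<in> facets r ` ?S. T \<in> e} = card E - r + 1" if T: "T \<in> ?V" for T
  proof -
    have finT: "finite T" "T \<subseteq> E" "card T = r - 1"
      using T fin by auto
    have "{e \<in> facets r ` ?S. T \<in> e} = facets r ` {S \<in> ?S. T \<subseteq> S}"
      using T by (auto simp: facets_def)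
    moreover have "inj_on (facets r) {S \<in> ?S. T \<subseteq> S}"
      using inj_on_facets[OF r, of E] by (rule inj_on_subset) auto
    ultimately have "card {e \<in> facets r ` ?S. T \<in> e} = card {S \<in> ?S. T \<subseteq> S}"
      by (simp add: card_image)
    also have "{S \<in> ?S. T \<subseteq> S} = (\<lambda>x. insert x T) ` (E - T)"
    proof
      show "(\<lambda>x. insert x T) ` (E - T) \<subseteq> {S \<in> ?S. T \<subseteq> S}"
        using finT r by auto
      show "{S \<in> ?S. T \<subseteq> S} \<subseteq> (\<lambda>x. insert x T) ` (E - T)"
      proof
        fix S assume "S \<in> {S \<in> ?S. T \<subseteq> S}"
        then have S: "S \<subseteq> E" "card S = r" "T \<subseteq> S" by auto
        have "card (S - T) = 1"
          using S finT r by (simp add: card_Diff_subset)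
        then obtain x where "S - T = {x}"
          by (rule card_1_singletonE)
        then have "S = insert x T" "x \<in> E - T"
          using S by auto
        then show "S \<in> (\<lambda>x. insert x T) ` (E - T)"
          by blast
      qed
    qed
    also have "card \<dots> = card (E - T)"
      by (intro card_image inj_onI) (auto dest: insert_ident)
    also have "\<dots> = card E - r + 1"
      using finT r n E by (simp add: card_Diff_subset)
    finally show ?thesis .
  qed
  show "card (e \<inter> f) \<le> 1" if ef: "e \<in> facets r ` ?S" "f \<in> facets r ` ?S" "e \<noteq> f" for e f
  proof -
    obtain S T where ST: "S \<in> ?S" "T \<in> ?S" "e = facets r S" "f = facets r T"
      using ef by auto
    then have fST: "finite S" "finite T" "S \<noteq> T"
      using fin ef by auto
    have "S \<inter> T \<subset> S"
      using ST fST card_subset_eq[of T S] by auto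
    then have c: "card (S \<inter> T) \<le> r - 1"
      using psubset_card_mono[of S "S \<inter> T"] fST ST by auto
    have "e \<inter> f = {U. U \<subseteq> S \<inter> T \<and> card U = r - 1}"
      using ST by (auto simp: facets_def)
    also have "card \<dots> = card (S \<inter> T) choose (r - 1)"
      using fST by (intro n_subsets) auto
    also have "\<dots> \<le> (r - 1) choose (r - 1)"
      using c by (rule binomial_right_mono)
    finally show ?thesis by simp
  qed
  show "?V \<noteq> {}"
  proof -
    obtain T where "T \<subseteq> E" "card T = r - 1"
      using obtain_subset_with_card_n[of "r - 1" E] n by (metis diff_le_self le_trans)
    then show ?thesis by auto
  qed
qed (use r n in auto)

lemma card_sp_family_eq:
  assumes E: "finite E" and r: "2 \<le> r" and n: "r \<le> card E"
  shows "card (sp_family E r) =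
    card (linear_hypergraph.all_matchings (facets r ` {S. S \<subseteq> E \<and> card S = r}))"
proof -
  let ?S = "{S. S \<subseteq> E \<and> card S = r}"
  interpret linear_hypergraph "{T. T \<subseteq> E \<and> card T = r - 1}" "facets r ` ?S" r "card E - r + 1"
    by (rule linear_hypergraph_facets[OF assms])
  have inj: "inj_on (facets r) ?S"
    by (rule inj_on_facets[OF r])
  have fin: "finite S" if "S \<in> ?S" for S
    using that finite_subset[of S E] E by auto
  have pw: "pairwise disjnt (facets r ` C) \<longleftrightarrow> (\<forall>S\<in>C. \<forall>T\<in>C. S \<noteq> T \<longrightarrow> card (S \<inter> T) < r - 1)"
    if C: "C \<subseteq> ?S" for C
  proof -
    have "facets r S = facets r T \<longleftrightarrow> S = T" if "S \<in> C" "T \<in> C" for S T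
      using inj_on_eq_iff[OF inj, of S T] C that by auto
    moreover have "disjnt (facets r S) (facets r T) \<longleftrightarrow> card (S \<inter> T) < r - 1" if "S \<in> C" "T \<in> C" for S T
      unfolding disjnt_def using C that by (intro facets_disjoint_iff fin) auto
    ultimately show ?thesis
      by (simp add: pairwise_def)
  qed
  have "bij_betw ((`) (facets r)) (Pow ?S) (Pow (facets r ` ?S))"
    using inj by (intro bij_betw_Pow) (simp add: bij_betw_def)
  then have injP: "inj_on ((`) (facets r)) (Pow ?S)" and imP: "(`) (facets r) ` Pow ?S = Pow (facets r ` ?S)"
    by (auto simp: bij_betw_def)
  have "all_matchings = (`) (facets r) ` sp_family E r"
  proof
    show "(`) (facets r) ` sp_family E r \<subseteq> all_matchings"
      using pw by (auto simp: all_matchings_def sp_family_def)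
    show "all_matchings \<subseteq> (`) (facets r) ` sp_family E r"
    proof
      fix M assume M: "M \<in> all_matchings"
      then have "M \<in> (`) (facets r) ` Pow ?S"
        unfolding imP by (auto simp: all_matchings_def)
      then obtain C where C: "C \<subseteq> ?S" "M = facets r ` C"
        by auto
      then have "C \<in> sp_family E r"
        using M pw[OF C(1)] by (auto simp: all_matchings_def sp_family_def)
      then show "M \<in> (`) (facets r) ` sp_family E r"
        using C by blast
    qed
  qed
  moreover have "inj_on ((`) (facets r)) (sp_family E r)"
    using injP by (rule inj_on_subset) (auto simp: sp_family_def)
  ultimately show ?thesis
    by (simp add: card_image)
qed

section \<open>Asymptotics\<close>

text \<open>\<open>x\<close> stands for the degree. The greedy count is run with
  \<open>\<epsilon> = x powr (-1/4)\<close>, \<open>\<theta> = x powr (1/2)\<close>,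
  \<open>\<delta> = x powr (-\<gamma>)\<close> and error bound \<open>x powr (-1/8)\<close>;
  \<open>152 = 8 * 19\<close> makes \<open>\<delta> ^ (19 * k)\<close> equal to
  \<open>x powr (-1/8)\<close>.\<close>

lemma eventually_lower_parameters:
  fixes k :: nat and \<eta> :: real
  assumes k: "2 \<le> k" and \<eta>: "0 < \<eta>"
  defines "\<gamma> \<equiv> 1 / (152 * real k)"
  shows "\<forall>\<^sub>F x :: real in at_top. 1 < x \<and> real k * x \<le> x\<^sup>2 / (real k)\<^sup>2 \<and> 2 * real k \<le> x powr (-\<gamma>) * (x\<^sup>2 / (real k)\<^sup>2)
    \<and> x powr (-1/8) \<le> 1 / 4 \<and> real k \<le> x powr (5/8) \<and> 64 * real k * x powr (1/2) \<le> x powr (5/8)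
    \<and> ln 4 + real k * ln (2 * x) \<le> x powr (1/4)
    \<and> 0 \<le> ln x + 1 - real k + ln (1 - x powr (-1/8))
    \<and> - \<eta> \<le> ln (1 - x powr (-1/8)) - x powr (-\<gamma>) * ln x - ln x / x - ln 2 / x"
proof -
  have kpos: "0 < real k" and \<gamma>: "0 < \<gamma>" "\<gamma> < 1"
    using k by (auto simp: \<gamma>_def)
  have 1: "\<forall>\<^sub>F x :: real in at_top. 1 < x" by real_asymp
  have 2: "\<forall>\<^sub>F x :: real in at_top. real k * x \<le> x\<^sup>2 / (real k)\<^sup>2" using kpos by real_asymp
  have 3: "\<forall>\<^sub>F x :: real in at_top. 2 * real k \<le> x powr (-\<gamma>) * (x\<^sup>2 / (real k)\<^sup>2)"
    using kpos \<gamma> by real_asymp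
  have 4: "\<forall>\<^sub>F x :: real in at_top. x powr (-1/8) \<le> 1 / 4" by real_asymp
  have 5: "\<forall>\<^sub>F x :: real in at_top. real k \<le> x powr (5/8)" using kpos by real_asymp
  have 6: "\<forall>\<^sub>F x :: real in at_top. 64 * real k * x powr (1/2) \<le> x powr (5/8)" using kpos by real_asymp
  have 7: "\<forall>\<^sub>F x :: real in at_top. ln 4 + real k * ln (2 * x) \<le> x powr (1/4)" using kpos by real_asymp
  have 8: "\<forall>\<^sub>F x :: real in at_top. 0 \<le> ln x + 1 - real k + ln (1 - x powr (-1/8))" using kpos by real_asymp
  have "((\<lambda>x :: real. ln (1 - x powr (-1/8)) - x powr (-\<gamma>) * ln x - ln x / x - ln 2 / x) \<longlongrightarrow> 0) at_top"
    using \<gamma> by real_asymp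
  then have 9: "\<forall>\<^sub>F x :: real in at_top. - \<eta> < ln (1 - x powr (-1/8)) - x powr (-\<gamma>) * ln x - ln x / x - ln 2 / x"
    using \<eta> by (intro order_tendstoD(1)) auto
  show ?thesis
    using 1 2 3 4 5 6 7 8 9 by eventually_elim auto
qed

text \<open>\<open>b\<close> is fixed first, so small that the error term proportional to
  \<open>p\<close> has slope below \<open>\<eta>\<close>; the other terms are logarithmic in
  \<open>p\<close>.\<close>

lemma eventually_upper_parameters:
  fixes k :: nat and \<eta> :: real
  assumes k: "2 \<le> k" and \<eta>: "0 < \<eta>"
  obtains a b :: real where "0 < a" "b = 2 * a" "b \<le> 1"
    "\<forall>\<^sub>F x :: real in at_top. 2 * real k ^ 2 \<le> a ^ k * ln x \<and> 2 \<le> a ^ k * x"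
    "\<forall>\<^sub>F p :: real in at_top. 2 \<le> a * p \<and>
       ln (real k * p + 1) + (real k - 1) * (ln p + 1) + real k * p * (b * (2 + ln (1 / b))) \<le> \<eta> * p"
proof -
  have kpos: "0 < real k"
    using k by simp
  have "((\<lambda>b :: real. real k * (b * (2 + ln (1 / b)))) \<longlongrightarrow> 0) (at_right 0)"
    by real_asymp
  then have "\<forall>\<^sub>F b :: real in at_right 0. real k * (b * (2 + ln (1 / b))) < \<eta>"
    using \<eta> by (intro order_tendstoD(2)) auto
  moreover have "\<forall>\<^sub>F b :: real in at_right 0. 0 < b \<and> b < 1"
    by (auto simp: eventually_at_right_field intro!: exI[of _ 1])
  ultimately have "\<forall>\<^sub>F b :: real in at_right 0. real k * (b * (2 + ln (1 / b))) < \<eta> \<and> 0 < b \<and> b < 1"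
    by eventually_elim auto
  then obtain b :: real where b: "real k * (b * (2 + ln (1 / b))) < \<eta>" "0 < b" "b < 1"
    using eventually_happens'[of "at_right (0 :: real)"] by auto
  define a where "a = b / 2"
  have a: "0 < a" and ak: "0 < a ^ k"
    using b by (auto simp: a_def)
  define c where "c = a ^ k"
  have c: "0 < c"
    using ak by (simp add: c_def)
  have 1: "\<forall>\<^sub>F x :: real in at_top. 2 * real k ^ 2 \<le> c * ln x"
    using kpos c by real_asymp
  have 2: "\<forall>\<^sub>F x :: real in at_top. 2 \<le> c * x"
    using c by real_asymp
  have 3: "\<forall>\<^sub>F p :: real in at_top. 2 \<le> a * p"
    using a by real_asymp
  define \<xi> where "\<xi> = \<eta> - real k * (b * (2 + ln (1 / b)))"
  have \<xi>: "0 < \<xi>"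
    using b by (simp add: \<xi>_def)
  have 4: "\<forall>\<^sub>F p :: real in at_top. ln (real k * p + 1) + (real k - 1) * (ln p + 1) \<le> \<xi> * p"
  proof -
    have "((\<lambda>p :: real. (ln (real k * p + 1) + (real k - 1) * (ln p + 1)) / p) \<longlongrightarrow> 0) at_top"
      using kpos by real_asymp
    then have "\<forall>\<^sub>F p :: real in at_top. (ln (real k * p + 1) + (real k - 1) * (ln p + 1)) / p < \<xi>"
      using \<xi> by (intro order_tendstoD(2)) auto
    moreover have "\<forall>\<^sub>F p :: real in at_top. 0 < p"
      by (rule eventually_gt_at_top)
    ultimately show ?thesis
      by eventually_elim (simp add: field_simps)
  qed
  show ?thesis
  proof (rule that[of a b])
    show "\<forall>\<^sub>F x :: real in at_top. 2 * real k ^ 2 \<le> a ^ k * ln x \<and> 2 \<le> a ^ k * x"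
      using 1 2 unfolding c_def by eventually_elim auto
    show "\<forall>\<^sub>F p :: real in at_top. 2 \<le> a * p \<and>
       ln (real k * p + 1) + (real k - 1) * (ln p + 1) + real k * p * (b * (2 + ln (1 / b))) \<le> \<eta> * p"
      using 3 4 by eventually_elim (auto simp: \<xi>_def algebra_simps)
  qed (use a b in \<open>auto simp: a_def\<close>)
qed

section \<open>Lower bound with explicit parameters\<close>

context linear_hypergraph
begin

lemma ln_card_all_matchings_ge:
  fixes \<eta> P x \<gamma> :: real
  assumes P: "P = real (card V) / real k" and x: "x = real D" and \<gamma>: "\<gamma> = 1 / (152 * real k)"
    and V: "x\<^sup>2 / (real k)\<^sup>2 \<le> real (card V)" "real (card V) \<le> (2 * x) ^ k"
    and par: "1 < x" "real k * x \<le> x\<^sup>2 / (real k)\<^sup>2" "2 * real k \<le> x powr (-\<gamma>) * (x\<^sup>2 / (real k)\<^sup>2)"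
      "x powr (-1/8) \<le> 1 / 4" "real k \<le> x powr (5/8)" "64 * real k * x powr (1/2) \<le> x powr (5/8)"
      "ln 4 + real k * ln (2 * x) \<le> x powr (1/4)"
      "0 \<le> ln x + 1 - real k + ln (1 - x powr (-1/8))"
      "- \<eta> \<le> ln (1 - x powr (-1/8)) - x powr (-\<gamma>) * ln x - ln x / x - ln 2 / x"
  shows "P * (ln x + 1 - real k - \<eta>) \<le> ln (real (card all_matchings))"
proof -
  have kpos: "0 < real k" and k2: "2 \<le> real k"
    using k_ge_2 by auto
  define \<delta> where "\<delta> = x powr (-\<gamma>)"
  \<comment> \<open>A single size suffices: the largest that leaves at least a fraction
    \<open>\<delta>\<close> of the vertices uncovered.\<close>
  define m where "m = nat \<lfloor>(1 - \<delta>) * P\<rfloor>"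
  have \<gamma>0: "0 < \<gamma>"
    using kpos \<gamma> by simp
  have "x powr (-\<gamma>) \<le> x powr 0"
    using par(1) \<gamma>0 by (intro powr_mono) auto
  then have \<delta>: "0 < \<delta>" "\<delta> \<le> 1"
    using par(1) by (auto simp: \<delta>_def)
  have Vx: "real k * x \<le> real (card V)"
    using V(1) par(2) by linarith
  then have Px: "x \<le> P"
    using kpos by (simp add: P field_simps)
  have P0: "0 < P"
    using Px par(1) by linarith
  have nonneg: "0 \<le> (1 - \<delta>) * P"
    using \<delta> P0 by simp
  have m: "real m \<le> (1 - \<delta>) * P" "(1 - \<delta>) * P - 1 \<le> real m"
    using nonneg unfolding m_def by linarith+
  have VP: "real (card V) = real k * P"
    using kpos by (simp add: P)
  have pow_\<delta>: "\<delta> ^ j = x powr (- (\<gamma> * real j))" for j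
    using par(1) by (simp add: \<delta>_def powr_realpow[symmetric] powr_powr)
  \<comment> \<open>\<open>\<delta> ^ (k - 1)\<close> is at least \<open>x powr (-1/8)\<close>, and
    \<open>1 - 1/4 - 1/8 = 5/8\<close>.\<close>
  have mean_ge: "x powr (5/8) \<le> x powr (-1/4) * (x * \<delta> ^ (k - 1))"
  proof -
    have "\<gamma> * real (k - 1) \<le> \<gamma> * real k"
      using \<gamma>0 by (intro mult_left_mono) auto
    also have "\<dots> \<le> 1 / 8"
      using kpos by (simp add: \<gamma>)
    finally have "x powr (5/8) \<le> x powr (-1/4 + (1 + (- (\<gamma> * real (k - 1)))))"
      using par(1) by (intro powr_mono) auto
    also have "\<dots> = x powr (-1/4) * (x powr 1 * x powr (- (\<gamma> * real (k - 1))))"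
      by (simp only: powr_add)
    also have "\<dots> = x powr (-1/4) * (x * \<delta> ^ (k - 1))"
      using par(1) by (simp add: pow_\<delta>)
    finally show ?thesis .
  qed
  have "real m * (ln (real D) + 1 - real k + ln (1 - x powr (-1/8))) - ln 2 \<le> ln (real (card (matchings m)))"
  proof (rule ln_card_matchings_ge[where \<epsilon> = "x powr (-1/4)" and \<theta> = "x powr (1/2)" and \<delta> = \<delta>])
    show "0 < x powr (1/2)" "0 < x powr (-1/4)"
      using par(1) by auto
    have "left m = real k * (P - real m)"
      by (simp add: left_def VP algebra_simps)
    also have "\<dots> \<ge> real k * (\<delta> * P)"
      using m(1) kpos by (intro mult_left_mono) (auto simp: algebra_simps)
    finally show "\<delta> * real (card V) \<le> left m"
      by (simp add: VP algebra_simps)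
    show "real k * real D \<le> real (card V)"
      using Vx by (simp add: x)
    have "\<delta> * (x\<^sup>2 / (real k)\<^sup>2) \<le> \<delta> * real (card V)"
      using V(1) \<delta> by (intro mult_left_mono) auto
    then show "2 * real k \<le> \<delta> * real (card V)"
      using par(3) unfolding \<delta>_def by linarith
    have "x powr (-1/4) / \<delta> ^ (19 * k) = x powr (-1/4 - (- (\<gamma> * real (19 * k))))"
      unfolding pow_\<delta> by (rule powr_diff[symmetric])
    also have "-1/4 - (- (\<gamma> * real (19 * k))) = -1/8"
      using kpos by (simp add: \<gamma> field_simps)
    finally show "x powr (-1/4) / \<delta> ^ (19 * k) \<le> x powr (-1/8)"
      by simp
    show "real k \<le> x powr (-1/4) * (real D * \<delta> ^ (k - 1))"
      "64 * real k * x powr (1/2) \<le> x powr (-1/4) * (real D * \<delta> ^ (k - 1))"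
      using mean_ge par(5,6) unfolding x by linarith+
    \<comment> \<open>\<open>\<theta> * \<epsilon>\<close> is \<open>x powr (1/4)\<close>, which
      dominates the logarithm of \<open>4 * card V\<close>.\<close>
    have "4 * real (card V) \<le> 4 * (2 * x) ^ k"
      using V(2) by simp
    also have "\<dots> = exp (ln 4 + real k * ln (2 * x))"
      using par(1) by (simp add: exp_add exp_of_nat_mult)
    also have "\<dots> \<le> exp (x powr (1/2) * x powr (-1/4))"
      using par(7) by (simp flip: powr_add)
    finally have "4 * real (card V) * exp (- (x powr (1/2) * x powr (-1/4)))
        \<le> exp (x powr (1/2) * x powr (-1/4)) * exp (- (x powr (1/2) * x powr (-1/4)))"
      by (intro mult_right_mono) auto
    then show "4 * real (card V) * exp (- (x powr (1/2) * x powr (-1/4))) \<le> 1"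
      by (simp flip: exp_add)
  qed (use \<delta> par in auto)
  also have "\<dots> \<le> ln (real (card all_matchings))"
  proof (cases "card (matchings m) = 0")
    \<comment> \<open>Here the default \<open>ln 0 = 0\<close> applies.\<close>
    case True
    have "1 \<le> card all_matchings"
      using card_matchings_le_all[of 0] by (simp add: matchings_0)
    then show ?thesis
      using True by simp
  next
    case False
    then show ?thesis
      using card_matchings_le_all[of m] by (subst ln_le_cancel_iff) auto
  qed
  finally have L: "real m * (ln x + 1 - real k + ln (1 - x powr (-1/8))) - ln 2 \<le> ln (real (card all_matchings))"
    by (simp add: x)
  define l where "l = ln (1 - x powr (-1/8))"
  define B where "B = ln x + 1 - real k + l"
  have l0: "l \<le> 0"
    using par(1,4) by (simp add: l_def)
  have B: "0 \<le> B" "B \<le> ln x"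
    using par(8) l0 k2 by (auto simp: B_def l_def)
  have lnx: "0 \<le> ln x"
    using par(1) by simp
  have Px': "1 \<le> P / x"
    using Px par(1) by simp
  \<comment> \<open>Stopping early costs the share \<open>\<delta>\<close>; rounding
    \<open>m\<close> and the term \<open>ln 2\<close> are additive losses, which
    \<open>x \<le> P\<close> makes negligible against \<open>P\<close>.\<close>
  have "P * (- \<eta>) \<le> P * (l - \<delta> * ln x - ln x / x - ln 2 / x)"
    using par(9) P0 by (intro mult_left_mono) (auto simp: l_def \<delta>_def)
  also have "\<dots> = P * l - \<delta> * P * ln x - (P / x) * ln x - (P / x) * ln 2"
    by (simp add: algebra_simps)
  also have "\<dots> \<le> P * l - \<delta> * P * B - 1 * B - 1 * ln 2"
    using Px' B lnx \<delta> P0 by (intro diff_mono order_refl mult_mono) auto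
  finally have "P * (ln x + 1 - real k - \<eta>) \<le> ((1 - \<delta>) * P - 1) * B - ln 2"
    by (simp add: B_def algebra_simps)
  also have "\<dots> \<le> real m * B - ln 2"
    using m(2) B by (intro diff_right_mono mult_right_mono) auto
  finally show ?thesis
    using L by (simp add: B_def l_def)
qed

end

text \<open>Here \<open>r \<ge> 3\<close> enters: as \<open>r - 1 \<ge> 2\<close>, the number of
  vertices is at least quadratic in the degree, so that it eventually exceeds
  \<open>k * D\<close>.\<close>

lemma card_vertices_bounds:
  assumes "3 \<le> r" "2 * r \<le> n"
  defines "x \<equiv> real (n - r + 1)"
  shows "x\<^sup>2 / (real r)\<^sup>2 \<le> real (n choose (r - 1))" "real (n choose (r - 1)) \<le> (2 * x) ^ r"
proof -
  have x: "x \<le> real n" "real n \<le> 2 * x" "1 \<le> 2 * x"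
    using assms by (auto simp: x_def)
  have "x / real r \<le> real n / real (r - 1)"
    using assms x by (intro frac_le) auto
  then have "(x / real r)\<^sup>2 \<le> (real n / real (r - 1))\<^sup>2"
    by (intro power_mono) (auto simp: x_def)
  also have "\<dots> \<le> (real n / real (r - 1)) ^ (r - 1)"
    using assms by (intro power_increasing) (auto simp: le_divide_eq)
  also have "\<dots> \<le> real (n choose (r - 1))"
    using assms by (intro binomial_ge_n_over_k_pow_k) auto
  finally show "x\<^sup>2 / (real r)\<^sup>2 \<le> real (n choose (r - 1))"
    by (simp add: power_divide)
  have "real (n choose (r - 1)) \<le> real (n ^ (r - 1))"
    using assms by (intro of_nat_mono binomial_le_pow) auto
  also have "\<dots> = real n ^ (r - 1)"
    by simp
  also have "\<dots> \<le> (2 * x) ^ (r - 1)"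
    using x by (intro power_mono) auto
  also have "\<dots> \<le> (2 * x) ^ r"
    using x by (intro power_increasing) auto
  finally show "real (n choose (r - 1)) \<le> (2 * x) ^ r" .
qed

text \<open>The prefactor in the theorem is the number of vertices divided by the edge size, that is
  \<open>P\<close>.\<close>

lemma choose_eq_facet_count:
  assumes "1 \<le> r" "r \<le> n"
  shows "1 / (real n - real r + 1) * real (n choose r) = real (n choose (r - 1)) / real r"
proof -
  have "r * (n choose r) = (n - r + 1) * (n choose (r - 1))"
  proof -
    have "Suc (r - 1) * (n choose Suc (r - 1)) = (n - (r - 1)) * (n choose (r - 1))"
      by (simp only: binomial_absorption binomial_absorb_comp)
    moreover have "Suc (r - 1) = r" "n - (r - 1) = n - r + 1"
      using assms by auto
    ultimately show ?thesis
      by (simp only:)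
  qed
  then have "real r * real (n choose r) = real (n - r + 1) * real (n choose (r - 1))"
    by (metis of_nat_mult)
  then show ?thesis
    using assms by (simp add: field_simps of_nat_diff)
qed

theorem theorem3:
  fixes r :: nat
  assumes "r \<ge> 3"
  shows "\<exists>\<epsilon> :: nat \<Rightarrow> real. \<epsilon> \<in> o(\<lambda>_. 1) \<and>
    (\<forall>n\<ge>r. ln (real (num_sparse_paving n r)) =
       1 / (real n - real r + 1) * real (n choose r) *
         (ln (real n - real r + 1) + 1 - real r + \<epsilon> n))"
proof -
  define P where "P n = real (n choose (r - 1)) / real r" for n
  define x where "x n = real (n - r + 1)" for n
  define L where "L n = ln (real (num_sparse_paving n r))" for n
  \<comment> \<open>The exact remainder: the identity then holds for every \<open>n \<ge> r\<close>,
    where \<open>P n\<close> is positive, and only the limit needs an argument.\<close>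
  define \<epsilon> where "\<epsilon> n = L n / P n - (ln (x n) + 1 - real r)" for n
  have x_top: "filterlim x at_top sequentially"
    unfolding x_def by real_asymp
  have large: "\<forall>\<^sub>F n in sequentially. 2 * r \<le> n"
    by (rule eventually_ge_at_top)
  have Px: "\<forall>\<^sub>F n in sequentially. (x n)\<^sup>2 / (real r)\<^sup>2 \<le> real r * P n"
    using large by eventually_elim (use assms card_vertices_bounds(1)[of r] in \<open>auto simp: P_def x_def\<close>)
  have P_top: "filterlim P at_top sequentially"
  proof -
    have "filterlim (\<lambda>y :: real. (y\<^sup>2 / (real r)\<^sup>2) / real r) at_top at_top"
      using assms by real_asymp
    then have "filterlim (\<lambda>n. ((x n)\<^sup>2 / (real r)\<^sup>2) / real r) at_top sequentially"
      using x_top by (rule filterlim_compose)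
    moreover have "\<forall>\<^sub>F n in sequentially. ((x n)\<^sup>2 / (real r)\<^sup>2) / real r \<le> P n"
      using Px by eventually_elim (use assms in \<open>auto simp: field_simps\<close>)
    ultimately show ?thesis
      by (rule filterlim_at_top_mono)
  qed
  have hyper: "linear_hypergraph {T. T \<subseteq> {1..n} \<and> card T = r - 1}
      (facets r ` {S. S \<subseteq> {1..n} \<and> card S = r}) r (n - r + 1)"
    and L_eq: "L n = ln (real (card (linear_hypergraph.all_matchings (facets r ` {S. S \<subseteq> {1..n} \<and> card S = r}))))"
    and card_V: "card {T. T \<subseteq> {1..n} \<and> card T = r - 1} = n choose (r - 1)"
    if "2 * r \<le> n" for n
    using that assms linear_hypergraph_facets[of "{1..n}" r] card_sp_family_eq[of "{1..n}" r]
      num_sparse_paving_eq[of r n] n_subsets[of "{1..n}" "r - 1"] by (auto simp: L_def)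
  \<comment> \<open>For given \<open>\<eta>\<close> the shift \<open>a\<close> and \<open>b\<close>
    are fixed before \<open>n\<close> grows; both bounds then agree with the main term up to
    \<open>\<eta> * P n\<close>.\<close>
  have "\<forall>\<^sub>F n in sequentially. norm (\<epsilon> n) \<le> \<eta> * norm (1 :: real)" if \<eta>: "0 < \<eta>" for \<eta> :: real
  proof -
    have r2: "2 \<le> r"
      using assms by simp
    obtain a b :: real where ab: "0 < a" "b = 2 * a" "b \<le> 1"
      and ab_x: "\<forall>\<^sub>F y :: real in at_top. 2 * real r ^ 2 \<le> a ^ r * ln y \<and> 2 \<le> a ^ r * y"
      and ab_P: "\<forall>\<^sub>F p :: real in at_top. 2 \<le> a * p \<and>
       ln (real r * p + 1) + (real r - 1) * (ln p + 1) + real r * p * (b * (2 + ln (1 / b))) \<le> \<eta> * p"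
      using eventually_upper_parameters[OF r2 \<eta>] .
    note low = eventually_compose_filterlim[OF eventually_lower_parameters[OF r2 \<eta>] x_top]
    show ?thesis
      using large low eventually_compose_filterlim[OF ab_x x_top] eventually_compose_filterlim[OF ab_P P_top]
    proof eventually_elim
      case (elim n)
      interpret linear_hypergraph "{T. T \<subseteq> {1..n} \<and> card T = r - 1}"
        "facets r ` {S. S \<subseteq> {1..n} \<and> card S = r}" r "n - r + 1"
        by (rule hyper[OF elim(1)])
      have P_eq: "P n = real (card {T. T \<subseteq> {1..n} \<and> card T = r - 1}) / real r"
        using card_V[OF elim(1)] by (simp add: P_def)
      have V_eq: "real (card {T. T \<subseteq> {1..n} \<and> card T = r - 1}) = real r * P n"
        using assms P_eq by simp
      have P0: "0 < P n"
        using elim(1) assms by (simp add: P_def)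
      have lower: "P n * (ln (x n) + 1 - real r - \<eta>) \<le> L n"
        unfolding L_eq[OF elim(1)]
        by (rule ln_card_all_matchings_ge[OF P_eq _ refl])
           (use elim assms card_vertices_bounds[of r n] card_V[OF elim(1)] in \<open>auto simp: x_def\<close>)
      have "L n \<le> ln (real r * P n + 1) + P n * (ln (x n) + 1 - real r)
          + (real r - 1) * (ln (P n) + 1) + real r * P n * (b * (2 + ln (1 / b)))"
        unfolding L_eq[OF elim(1)] x_def
        by (rule ln_card_all_matchings_le[OF P_eq ab, unfolded V_eq]) (use elim in \<open>auto simp: x_def\<close>)
      then have upper: "L n \<le> P n * (ln (x n) + 1 - real r) + \<eta> * P n"
        using elim(4) by linarith
      have "L n / P n \<le> ln (x n) + 1 - real r + \<eta>" "ln (x n) + 1 - real r - \<eta> \<le> L n / P n"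
        using lower upper P0 by (simp_all add: field_simps)
      then show ?case
        by (simp add: \<epsilon>_def abs_le_iff)
    qed
  qed
  then have "\<epsilon> \<in> o(\<lambda>_. 1)"
    by (rule landau_o.smallI)
  moreover have "L n = 1 / (real n - real r + 1) * real (n choose r) *
      (ln (real n - real r + 1) + 1 - real r + \<epsilon> n)" if n: "r \<le> n" for n
  proof -
    have "0 < P n" "x n = real n - real r + 1"
      using n assms by (auto simp: P_def x_def of_nat_diff)
    then show ?thesis
      using choose_eq_facet_count[of r n] n assms by (simp add: \<epsilon>_def P_def)
  qed
  ultimately show ?thesis
    unfolding L_def by blast
qed

end
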